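(* Let $A$ be a regular weak multiplier Hopf algebra with counit $\varepsilon$. If $A$ is Frobenius and $\varepsilon\in\widetilde A$, then $A$ has a (left) cointegral.
   Context: All algebras are over $\mathbb{C}$, associative, possibly non-unital, with non-degenerate product. $A$ is idempotent if $A^2=A$; $M(A)$ is the multiplier algebra (identity $1$); $A'$ is the space of all linear functionals on $A$. A coproduct is a homomorphism $\Delta:A\to M(A\otimes A)$ with $\Delta(a)(1\otimes b),(a\otimes 1)\Delta(b)\in A\otimes A$, coassociative: $(a\otimes1\otimes1)(\Delta\otimes id)(\Delta(b)(1\otimes c))=(id\otimes\Delta)((a\otimes1)\Delta(b))(1\otimes1\otimes c)$. Put $T_1(a\otimes b)=\Delta(a)(1\otimes b)$, $T_2(a\otimes b)=(a\otimes1)\Delta(b)$. $\Delta$ is full if the smallest subspaces $V,W\subset A$ with $\Delta(A)(1\otimes A)\subset V\otimes A$ and $(A\otimes1)\Delta(A)\subset A\otimes W$ both equal $A$. A counit is a linear functional $\varepsilon$ with $(\varepsilon\otimes id)(\Delta(a)(1\otimes b))=ab$, $(id\otimes\varepsilon)((c\otimes1)\Delta(a))=ca$. A weak multiplier Hopf algebra is a non-degenerate idempotent algebra $A$ with a full coproduct $\Delta$ and a counit $\varepsilon$ such that: (i) there is an idempotent $E\in M(A\otimes A)$ with $T_1(A\otimes A)=E(A\otimes A)$, $T_2(A\otimes A)=(A\otimes A)E$; (ii) $(id\otimes\Delta)E=(E\otimes1)(1\otimes E)=(1\otimes E)(E\otimes1)$; (iii) $\mathrm{Ker}(T_i)=(1-G_i)(A\otimes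 A)$, $i=1,2$, where $G_1,G_2$ are the linear maps on $A\otimes A$ given by $(G_1\otimes id)(\Delta_{13}(a)(1\otimes b\otimes c))=\Delta_{13}(a)(1\otimes E)(1\otimes b\otimes c)$ and $(id\otimes G_2)((a\otimes b\otimes1)\Delta_{13}(c))=(a\otimes b\otimes1)(E\otimes1)\Delta_{13}(c)$. Here $\Delta$ (and likewise $id\otimes\Delta$) is uniquely extended to multipliers, with $\Delta(1)=E$. With Sweedler notation $\Delta(a)=\sum a_{(1)}\otimes a_{(2)}$, the antipode $S$ is the non-degenerate anti-homomorphism $A\to M(A)$ with $E(a\otimes b)=\sum a_{(1)}\otimes a_{(2)}S(a_{(3)})b$, $(a\otimes b)E=\sum aS(b_{(1)})b_{(2)}\otimes b_{(3)}$, $G_1(a\otimes b)=\sum a_{(1)}\otimes S(a_{(2)})a_{(3)}b$, $G_2(a\otimes b)=\sum ab_{(1)}S(b_{(2)})\otimes b_{(3)}$, $\sum S(a_{(1)})a_{(2)}S(a_{(3)})=S(a)$; it extends to $M(A)$. $A$ is regular if $S$ is bijective from $A$ to $A$; then also $\Delta(a)(b\otimes1),(1\otimes a)\Delta(b)\in A\otimes A$. Put $\varepsilon_t(a)=\sum a_{(1)}S(a_{(2)})$. A left cointegral is a non-zero $h\in M(A)$ with $ah=\varepsilon_t(a)h$ for all $a\in A$. $A'$ is a left $A$-module via $a\omega=\omega(\cdot\,a)$, i.e. $(a\omega)(b)=\omega(ba)$, and $AA'=\widetilde A=\{\omega(\cdot\,a):a\in A,\omega\in A'\}$. An algebra $A$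 (possibly infinite-dimensional, possibly without identity) is called Frobenius if there is a left $A$-module isomorphism from $A$ to $AA'$. *)

theory Defs
  imports Complex_Main "HOL-Library.Poly_Mapping"
begin

section \<open>Complex vector spaces and (possibly non-unital) complex algebras\<close>

class complex_vec = ab_group_add +
  fixes scaleC :: "complex \<Rightarrow> 'a \<Rightarrow> 'a" (infixr "*\<^sub>C" 75)
  assumes scaleC_add_right: "c *\<^sub>C (x + y) = c *\<^sub>C x + c *\<^sub>C y"
    and scaleC_add_left: "(c + d) *\<^sub>C x = c *\<^sub>C x + d *\<^sub>C x"
    and scaleC_scaleC [simp]: "c *\<^sub>C (d *\<^sub>C x) = (c * d) *\<^sub>C x"
    and scaleC_one [simp]: "1 *\<^sub>C x = x"

global_interpretation cvec: vector_space "scaleC :: complex \<Rightarrow> 'a \<Rightarrow> 'a::complex_vec"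
  by unfold_locales (simp_all add: scaleC_add_right scaleC_add_left)

global_interpretation cvec_pair: vector_space_pair
  "scaleC :: complex \<Rightarrow> 'a \<Rightarrow> 'a::complex_vec" "scaleC :: complex \<Rightarrow> 'b \<Rightarrow> 'b::complex_vec"
  by unfold_locales

abbreviation clinear :: "('a::complex_vec \<Rightarrow> 'b::complex_vec) \<Rightarrow> bool"
  where "clinear \<equiv> Vector_Spaces.linear scaleC scaleC"

lemma clinear_iff:
  "clinear f \<longleftrightarrow> (\<forall>x y. f (x + y) = f x + f y) \<and> (\<forall>c x. f (c *\<^sub>C x) = c *\<^sub>C f x)"
  by (simp add: Vector_Spaces.linear_iff cvec.vector_space_axioms)

class complex_algebra = complex_vec + ring +
  assumes scaleC_mult_left [simp]: "(c *\<^sub>C x) * y = c *\<^sub>C (x * y)"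
    and scaleC_mult_right [simp]: "x * (c *\<^sub>C y) = c *\<^sub>C (x * y)"

class nondegenerate_algebra = complex_algebra +
  assumes nondegenerate_left: "(\<And>b. a * b = 0) \<Longrightarrow> a = 0"
    and nondegenerate_right: "(\<And>b. b * a = 0) \<Longrightarrow> a = 0"

instantiation complex :: nondegenerate_algebra
begin
definition scaleC_complex :: "complex \<Rightarrow> complex \<Rightarrow> complex"
  where "scaleC_complex = (*)"
instance
proof
  show "a = 0" if "\<And>b. a * b = 0" for a :: complex
    using that[of 1] by simp
  show "a = 0" if "\<And>b. b * a = 0" for a :: complex
    using that[of 1] by simp
qed (simp_all add: scaleC_complex_def algebra_simps)
end

lemma clinear_functional_iff:
  "clinear f \<longleftrightarrow> (\<forall>x y. f (x + y) = f x + f y) \<and> (\<forall>c x. f (c *\<^sub>C x) = c * f x)"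
  for f :: "'a::complex_vec \<Rightarrow> complex"
  by (simp add: clinear_iff) (simp add: scaleC_complex_def)

definition idempotent_algebra :: "'a::complex_algebra itself \<Rightarrow> bool"
  where "idempotent_algebra _ \<longleftrightarrow> cvec.span {a * b |a b :: 'a. True} = UNIV"

instantiation poly_mapping :: (type, complex_vec) complex_vec
begin
definition scaleC_poly_mapping :: "complex \<Rightarrow> ('a \<Rightarrow>\<^sub>0 'b) \<Rightarrow> 'a \<Rightarrow>\<^sub>0 'b"
  where "scaleC_poly_mapping c = Poly_Mapping.map (scaleC c)"
lemma lookup_scaleC [simp]:
  "Poly_Mapping.lookup (c *\<^sub>C p) k = c *\<^sub>C Poly_Mapping.lookup p k"
  by (simp add: scaleC_poly_mapping_def map.rep_eq when_def)
instance
  by standard (auto intro!: poly_mapping_eqI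
      simp: lookup_add scaleC_add_right scaleC_add_left)
end


section \<open>The algebraic tensor product\<close>

text \<open>The free complex vector space on \<open>'a \<times> 'b\<close>, modulo the bilinearity relations.\<close>

definition tensor_relators :: "(('a::complex_vec \<times> 'b::complex_vec) \<Rightarrow>\<^sub>0 complex) set"
  where "tensor_relators =
    {Poly_Mapping.single (a + a', b) 1
       - (Poly_Mapping.single (a, b) 1 + Poly_Mapping.single (a', b) 1) |a a' b. True} \<union>
    {Poly_Mapping.single (a, b + b') 1
       - (Poly_Mapping.single (a, b) 1 + Poly_Mapping.single (a, b') 1) |a b b'. True} \<union>
    {Poly_Mapping.single (c *\<^sub>C a, b) 1 - c *\<^sub>C Poly_Mapping.single (a, b) 1 |c a b. True} \<union>
    {Poly_Mapping.single (a, c *\<^sub>C b) 1 - c *\<^sub>C Poly_Mapping.single (a, b) 1 |c a b. True}"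

definition tensor_rel ::
  "(('a::complex_vec \<times> 'b::complex_vec) \<Rightarrow>\<^sub>0 complex) \<Rightarrow> (('a \<times> 'b) \<Rightarrow>\<^sub>0 complex) \<Rightarrow> bool"
  where "tensor_rel p q \<longleftrightarrow> p - q \<in> cvec.span tensor_relators"

quotient_type (overloaded) ('a, 'b) tensor (infixr "\<otimes>" 72) =
  "('a::complex_vec \<times> 'b::complex_vec) \<Rightarrow>\<^sub>0 complex" / tensor_rel
proof (rule equivpI)
  show "reflp (tensor_rel :: ('a \<times> 'b \<Rightarrow>\<^sub>0 complex) \<Rightarrow> _)"
    by (simp add: reflp_def tensor_rel_def cvec.span_zero)
  show "symp (tensor_rel :: ('a \<times> 'b \<Rightarrow>\<^sub>0 complex) \<Rightarrow> _)"
    unfolding symp_def tensor_rel_def by (metis cvec.span_neg minus_diff_eq)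
  show "transp (tensor_rel :: ('a \<times> 'b \<Rightarrow>\<^sub>0 complex) \<Rightarrow> _)"
  proof (rule transpI)
    fix p q r :: "'a \<times> 'b \<Rightarrow>\<^sub>0 complex"
    assume "tensor_rel p q" "tensor_rel q r"
    then have "(p - q) + (q - r) \<in> cvec.span tensor_relators"
      unfolding tensor_rel_def by (rule cvec.span_add)
    then show "tensor_rel p r" by (simp add: tensor_rel_def)
  qed
qed

instantiation tensor :: (complex_vec, complex_vec) complex_vec
begin
lift_definition zero_tensor :: "('a, 'b) tensor" is 0 .
lift_definition plus_tensor :: "('a, 'b) tensor \<Rightarrow> ('a, 'b) tensor \<Rightarrow> ('a, 'b) tensor" is "(+)"
  unfolding tensor_rel_def by (metis add_diff_add cvec.span_add)
lift_definition uminus_tensor :: "('a, 'b) tensor \<Rightarrow> ('a, 'b) tensor" is uminus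
  unfolding tensor_rel_def by (metis cvec.span_neg minus_diff_minus)
lift_definition minus_tensor :: "('a, 'b) tensor \<Rightarrow> ('a, 'b) tensor \<Rightarrow> ('a, 'b) tensor" is "(-)"
proof -
  fix p p' q q' :: "'a \<times> 'b \<Rightarrow>\<^sub>0 complex"
  assume "tensor_rel p p'" "tensor_rel q q'"
  then have "(p - p') - (q - q') \<in> cvec.span tensor_relators"
    unfolding tensor_rel_def by (rule cvec.span_diff)
  then show "tensor_rel (p - q) (p' - q')" by (simp add: tensor_rel_def algebra_simps)
qed
lift_definition scaleC_tensor :: "complex \<Rightarrow> ('a, 'b) tensor \<Rightarrow> ('a, 'b) tensor" is scaleC
  unfolding tensor_rel_def by (metis cvec.scale_right_diff_distrib cvec.span_scale)
instance
  by standard (transfer; simp add: tensor_rel_def cvec.span_zero scaleC_add_right scaleC_add_left)+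
end

lift_definition tens :: "'a::complex_vec \<Rightarrow> 'b::complex_vec \<Rightarrow> ('a, 'b) tensor" (infixr "\<otimes>" 72)
  is "\<lambda>a b. Poly_Mapping.single (a, b) 1" .

lemma
  shows tens_add_left: "(a + a') \<otimes> b = a \<otimes> b + a' \<otimes> b"
    and tens_add_right: "a \<otimes> (b + b') = a \<otimes> b + a \<otimes> b'"
    and tens_scaleC_left: "(c *\<^sub>C a) \<otimes> b = c *\<^sub>C (a \<otimes> b)"
    and tens_scaleC_right: "a \<otimes> (c *\<^sub>C b) = c *\<^sub>C (a \<otimes> b)"
  by (transfer, unfold tensor_rel_def, rule cvec.span_base, unfold tensor_relators_def, blast)+

lemma tensor_induct [case_names tens add, induct type: tensor]:
  assumes tens: "\<And>a b. P (a \<otimes> b)" and add: "\<And>x y. P x \<Longrightarrow> P y \<Longrightarrow> P (x + y)"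
  shows "P t"
proof -
  obtain p where "t = abs_tensor p"
    by (metis Quotient3_abs_rep Quotient3_tensor)
  moreover have "P (abs_tensor p)"
  proof (induction p rule: update_induct)
    case const
    have "abs_tensor 0 = 0 \<otimes> 0"
      using tens_scaleC_left[of 0 0 0] by (simp add: zero_tensor.abs_eq[symmetric])
    then show ?case using tens by metis
  next
    case (update p k v)
    obtain a b where k: "k = (a, b)" by force
    have "Poly_Mapping.update k v p = p + v *\<^sub>C Poly_Mapping.single (a, b) 1"
      using update(1) by (intro poly_mapping_eqI)
        (auto simp: lookup_add lookup_update lookup_single when_def k in_keys_iff scaleC_complex_def)
    then have "abs_tensor (Poly_Mapping.update k v p) = abs_tensor p + (v *\<^sub>C a) \<otimes> b"
      by (simp add: tens_scaleC_left flip: tens.abs_eq scaleC_tensor.abs_eq plus_tensor.abs_eq)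
    with update tens add show ?case by metis
  qed
  ultimately show ?thesis by simp
qed

definition cbilinear :: "('a::complex_vec \<Rightarrow> 'b::complex_vec \<Rightarrow> 'c::complex_vec) \<Rightarrow> bool"
  where "cbilinear f \<longleftrightarrow> (\<forall>a. clinear (f a)) \<and> (\<forall>b. clinear (\<lambda>a. f a b))"

text \<open>The linear map on the tensor product induced by a bilinear map (universal property).\<close>

definition tlift :: "('a::complex_vec \<Rightarrow> 'b::complex_vec \<Rightarrow> 'c::complex_vec) \<Rightarrow> ('a \<otimes> 'b) \<Rightarrow> 'c"
  where "tlift f = (THE g. clinear g \<and> (\<forall>a b. g (a \<otimes> b) = f a b))"

lemma tensor_clinear_eqI:
  assumes "clinear f" "clinear g" "\<And>a b. f (a \<otimes> b) = g (a \<otimes> b)"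
  shows "f = g"
proof
  show "f t = g t" for t
    using assms by (induction t) (simp_all add: clinear_iff)
qed

lemma tlift_exists:
  fixes f :: "'a::complex_vec \<Rightarrow> 'b::complex_vec \<Rightarrow> 'c::complex_vec"
  assumes f: "cbilinear f"
  shows "\<exists>g. clinear g \<and> (\<forall>a b. g (a \<otimes> b) = f a b)"
proof -
  define F where "F p = (\<Sum>k\<in>Poly_Mapping.keys p. Poly_Mapping.lookup p k *\<^sub>C f (fst k) (snd k))"
    for p :: "('a \<times> 'b) \<Rightarrow>\<^sub>0 complex"
  have lookup_0: "Poly_Mapping.lookup p k = 0" if "k \<notin> Poly_Mapping.keys p" for p :: "('a \<times> 'b) \<Rightarrow>\<^sub>0 complex" and k
    using that by (meson in_keys_iff)
  have F_eq: "F p = (\<Sum>k\<in>S. Poly_Mapping.lookup p k *\<^sub>C f (fst k) (snd k))"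
    if "finite S" "Poly_Mapping.keys p \<subseteq> S" for p S
    unfolding F_def using that
    by (intro sum.mono_neutral_left) (auto simp: lookup_0)
  have F_add: "F (p + q) = F p + F q" for p q
    using Poly_Mapping.keys_add[of p q]
    by (simp add: F_eq[of "Poly_Mapping.keys p \<union> Poly_Mapping.keys q"] lookup_add scaleC_add_left sum.distrib)
  have F_scale: "F (c *\<^sub>C p) = c *\<^sub>C F p" for c p
    by (subst F_eq[of "Poly_Mapping.keys p"])
      (auto simp: in_keys_iff F_def cvec.scale_sum_right scaleC_complex_def)
  have lin: "clinear F" by (simp add: clinear_iff F_add F_scale)
  have F_single: "F (Poly_Mapping.single (a, b) 1) = f a b" for a b
    by (simp add: F_def)
  have bil: "f (a + a') b = f a b + f a' b" "f a (b + b') = f a b + f a b'"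
    "f (c *\<^sub>C a) b = c *\<^sub>C f a b" "f a (c *\<^sub>C b) = c *\<^sub>C f a b" for a a' b b' c
    using f by (auto simp: cbilinear_def clinear_iff)
  have diff: "F (p - q) = F p - F q" for p q
    using lin by (rule cvec_pair.linear_diff)
  have "F r = 0" if "r \<in> tensor_relators" for r
    using that by (auto simp: tensor_relators_def diff F_add F_scale F_single bil)
  then have zero: "F r = 0" if "r \<in> cvec.span tensor_relators" for r
    using that cvec_pair.linear_eq_0_on_span[OF lin] by blast
  have resp: "F p = F q" if "tensor_rel p q" for p q
    using zero that diff[of p q] by (simp add: tensor_rel_def)
  define g where "g t = F (rep_tensor t)" for t
  have g_abs: "g (abs_tensor p) = F p" for p
    unfolding g_def by (rule resp) (meson Quotient3_rep_abs Quotient3_tensor tensor_equivp equivp_reflp)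
  have ex_abs: "\<exists>p. t = abs_tensor p" for t :: "'a \<otimes> 'b"
    by (metis Quotient3_abs_rep Quotient3_tensor)
  have "g (s + t) = g s + g t" for s t
    using ex_abs[of s] ex_abs[of t] by (auto simp: plus_tensor.abs_eq g_abs F_add)
  moreover have "g (c *\<^sub>C t) = c *\<^sub>C g t" for c t
    using ex_abs[of t] by (auto simp: scaleC_tensor.abs_eq g_abs F_scale)
  moreover have "g (a \<otimes> b) = f a b" for a b
    by (simp add: tens.abs_eq g_abs F_single)
  ultimately show ?thesis by (auto simp: clinear_iff)
qed

lemma
  assumes "cbilinear f"
  shows clinear_tlift: "clinear (tlift f)" and tlift_tens: "tlift f (a \<otimes> b) = f a b"
proof -
  have "\<exists>!g. clinear g \<and> (\<forall>a b. g (a \<otimes> b) = f a b)"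
    using tlift_exists[OF assms] tensor_clinear_eqI by (metis (no_types, lifting))
  then have "clinear (tlift f) \<and> (\<forall>a b. tlift f (a \<otimes> b) = f a b)"
    unfolding tlift_def by (rule theI')
  then show "clinear (tlift f)" "tlift f (a \<otimes> b) = f a b" by auto
qed

lemma tlift_add: "cbilinear f \<Longrightarrow> tlift f (x + y) = tlift f x + tlift f y"
  and tlift_scaleC: "cbilinear f \<Longrightarrow> tlift f (c *\<^sub>C x) = c *\<^sub>C tlift f x"
  using clinear_tlift[of f] by (auto simp: clinear_iff)

definition tmap :: "('a::complex_vec \<Rightarrow> 'c::complex_vec) \<Rightarrow> ('b::complex_vec \<Rightarrow> 'd::complex_vec)
    \<Rightarrow> ('a \<otimes> 'b) \<Rightarrow> ('c \<otimes> 'd)"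
  where "tmap f g = tlift (\<lambda>a b. f a \<otimes> g b)"

lemma tmap_bilinear: "clinear f \<Longrightarrow> clinear g \<Longrightarrow> cbilinear (\<lambda>a b. f a \<otimes> g b)"
  by (simp add: cbilinear_def clinear_iff tens_add_left tens_add_right tens_scaleC_left tens_scaleC_right)

lemma
  assumes "clinear f" "clinear g"
  shows clinear_tmap: "clinear (tmap f g)" and tmap_tens [simp]: "tmap f g (a \<otimes> b) = f a \<otimes> g b"
  unfolding tmap_def using tmap_bilinear[OF assms]
  by (simp_all add: clinear_tlift tlift_tens)

instantiation tensor :: (complex_algebra, complex_algebra) complex_algebra
begin

definition times_tensor :: "('a \<otimes> 'b) \<Rightarrow> ('a \<otimes> 'b) \<Rightarrow> ('a \<otimes> 'b)"
  where "times_tensor x y = tlift (\<lambda>a b. tmap ((*) a) ((*) b) y) x"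

lemma clinear_mult_left: "clinear ((*) (a :: 'c::complex_algebra))"
  and clinear_mult_right: "clinear (\<lambda>b :: 'c::complex_algebra. b * a)"
  by (simp_all add: clinear_iff distrib_left distrib_right)

lemma tmap_mult_tens: "tmap ((*) a) ((*) b) (c \<otimes> d) = (a * c) \<otimes> (b * d)"
  for a c :: "'c::complex_algebra" and b d :: "'d::complex_algebra"
  by (rule tmap_tens) (rule clinear_mult_left)+

lemma tmap_mult_linear:
  "tmap ((*) a) ((*) b) (x + y) = tmap ((*) a) ((*) b) x + tmap ((*) a) ((*) b) y"
  "tmap ((*) a) ((*) b) (c *\<^sub>C x) = c *\<^sub>C tmap ((*) a) ((*) b) x"
  for a :: "'c::complex_algebra" and b :: "'d::complex_algebra"
  using clinear_tmap[OF clinear_mult_left clinear_mult_left, of a b] by (auto simp: clinear_iff)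

lemma times_tensor_bilinear: "cbilinear (\<lambda>a b. tmap ((*) a) ((*) b) (y :: 'a \<otimes> 'b))"
proof (induction y)
  case (tens c d)
  then show ?case
    by (simp add: tmap_mult_tens cbilinear_def clinear_iff distrib_right
        tens_add_left tens_add_right tens_scaleC_left tens_scaleC_right)
next
  case (add x y)
  then show ?case
    by (simp add: tmap_mult_linear cbilinear_def clinear_iff scaleC_add_right algebra_simps)
qed

lemma times_tens_eq: "(a \<otimes> b) * z = tmap ((*) a) ((*) b) z" for a :: 'a and b :: 'b
  by (simp add: times_tensor_def tlift_tens times_tensor_bilinear)

lemma tens_mult_tens [simp]: "(a \<otimes> b) * (c \<otimes> d) = (a * c) \<otimes> (b * d)"
  for a c :: 'a and b d :: 'b
  by (simp add: times_tens_eq tmap_mult_tens)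

instance
proof
  fix x y z :: "'a \<otimes> 'b" and c :: complex
  show left: "(x + y) * z = x * z + y * z" for x y z :: "'a \<otimes> 'b"
    by (simp add: times_tensor_def tlift_add times_tensor_bilinear)
  show scale: "c *\<^sub>C x * y = c *\<^sub>C (x * y)" for x y :: "'a \<otimes> 'b"
    by (simp add: times_tensor_def tlift_scaleC times_tensor_bilinear)
  show right: "x * (y + z) = x * y + x * z" for x y z :: "'a \<otimes> 'b"
    by (induction x) (simp_all add: times_tens_eq tmap_mult_linear left algebra_simps)
  show "x * c *\<^sub>C y = c *\<^sub>C (x * y)"
    by (induction x) (simp_all add: times_tens_eq tmap_mult_linear left scaleC_add_right)
  show "x * y * z = x * (y * z)"
  proof (induction x)
    case x: (tens a b)
    show ?case
    proof (induction y)
      case y: (tens a' b')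
      show ?case by (induction z) (simp_all add: right mult.assoc)
    qed (simp_all add: left right)
  qed (simp_all add: left right)
qed

end

text \<open>For linear functionals \<open>f\<close>, \<open>g\<close>, the slice maps \<open>f \<otimes> id\<close> and \<open>id \<otimes> g\<close>,
  with \<open>\<complex> \<otimes> B\<close> and \<open>A \<otimes> \<complex>\<close> identified with \<open>B\<close> and \<open>A\<close>.\<close>

definition fun_tens_id :: "('a::complex_vec \<Rightarrow> complex) \<Rightarrow> ('a \<otimes> 'b::complex_vec) \<Rightarrow> 'b"
  where "fun_tens_id f = tlift (\<lambda>a b. f a *\<^sub>C b)"

definition id_tens_fun :: "('b::complex_vec \<Rightarrow> complex) \<Rightarrow> ('a::complex_vec \<otimes> 'b) \<Rightarrow> 'a"
  where "id_tens_fun g = tlift (\<lambda>a b. g b *\<^sub>C a)"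

lemma
  fixes f :: "'a::complex_vec \<Rightarrow> complex" and b :: "'b::complex_vec" and b' :: "'c::complex_vec"
  assumes "clinear f"
  shows fun_tens_id_tens [simp]: "fun_tens_id f (a \<otimes> b) = f a *\<^sub>C b"
    and fun_tens_id_add [simp]: "fun_tens_id f (x + y :: 'a \<otimes> 'b) = fun_tens_id f x + fun_tens_id f y"
    and id_tens_fun_tens [simp]: "id_tens_fun f (b' \<otimes> a) = f a *\<^sub>C b'"
    and id_tens_fun_add [simp]: "id_tens_fun f (x' + y' :: 'c \<otimes> 'a) = id_tens_fun f x' + id_tens_fun f y'"
proof -
  have "cbilinear (\<lambda>a (b::'b). f a *\<^sub>C b)" "cbilinear (\<lambda>(b::'c) a. f a *\<^sub>C b)"
    using assms unfolding clinear_functional_iff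
    by (auto simp: cbilinear_def clinear_iff scaleC_add_left scaleC_add_right mult.commute)
  then show "fun_tens_id f (a \<otimes> b) = f a *\<^sub>C b"
    "fun_tens_id f (x + y :: 'a \<otimes> 'b) = fun_tens_id f x + fun_tens_id f y"
    "id_tens_fun f (b' \<otimes> a) = f a *\<^sub>C b'"
    "id_tens_fun f (x' + y' :: 'c \<otimes> 'a) = id_tens_fun f x' + id_tens_fun f y'"
    by (simp_all add: fun_tens_id_def id_tens_fun_def tlift_tens tlift_add)
qed

lemma basis_coordinates:
  obtains r :: "'a::complex_vec \<Rightarrow> 'a \<Rightarrow> complex"
  where "\<And>b. clinear (r b)" "\<And>v. finite {b. r b v \<noteq> 0}"
    "\<And>v F. finite F \<Longrightarrow> {b. r b v \<noteq> 0} \<subseteq> F \<Longrightarrow> (\<Sum>b\<in>F. r b v *\<^sub>C b) = v"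
proof -
  define B where "B = cvec.extend_basis ({} :: 'a set)"
  have B: "cvec.independent B" "cvec.span B = UNIV"
    unfolding B_def using cvec.independent_extend_basis[OF cvec.independent_empty]
      cvec.span_extend_basis[OF cvec.independent_empty] by auto
  show ?thesis
  proof (rule that[of "\<lambda>b v. cvec.representation B v b"])
    show "clinear (\<lambda>v. cvec.representation B v b)" for b
      using cvec.linear_representation[OF B] by (simp add: scaleC_complex_def)
    show "finite {b. cvec.representation B v b \<noteq> 0}" for v
      by (rule cvec.finite_representation)
    fix v :: 'a and F :: "'a set"
    assume F: "finite F" "{b. cvec.representation B v b \<noteq> 0} \<subseteq> F"
    have "(\<Sum>b\<in>F. cvec.representation B v b *\<^sub>C b)
        = (\<Sum>b | cvec.representation B v b \<noteq> 0. cvec.representation B v b *\<^sub>C b)"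
      by (rule sum.mono_neutral_right) (use F in auto)
    also have "\<dots> = v"
      by (rule cvec.sum_nonzero_representation_eq) (simp_all add: B)
    finally show "(\<Sum>b\<in>F. cvec.representation B v b *\<^sub>C b) = v" .
  qed
qed

lemma functionals_separate:
  fixes v :: "'a::complex_vec"
  assumes "\<And>f. clinear f \<Longrightarrow> f v = (0::complex)"
  shows "v = 0"
proof -
  obtain r :: "'a \<Rightarrow> 'a \<Rightarrow> complex" where r: "\<And>b. clinear (r b)"
    "\<And>v. finite {b. r b v \<noteq> 0}"
    "\<And>v F. finite F \<Longrightarrow> {b. r b v \<noteq> 0} \<subseteq> F \<Longrightarrow> (\<Sum>b\<in>F. r b v *\<^sub>C b) = v"
    by (rule basis_coordinates) (rule that)
  show ?thesis using r(3)[of "{}" v] assms[OF r(1)] by simp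
qed

lemma slices_separate:
  fixes x :: "'a::complex_vec \<otimes> 'b::complex_vec"
  assumes "\<And>g. clinear g \<Longrightarrow> id_tens_fun g x = 0"
  shows "x = 0"
proof -
  obtain r :: "'b \<Rightarrow> 'b \<Rightarrow> complex" where r: "\<And>b. clinear (r b)"
    "\<And>v. finite {b. r b v \<noteq> 0}"
    "\<And>v F. finite F \<Longrightarrow> {b. r b v \<noteq> 0} \<subseteq> F \<Longrightarrow> (\<Sum>b\<in>F. r b v *\<^sub>C b) = v"
    by (rule basis_coordinates) (rule that)
  have tens_sum: "(\<Sum>e\<in>F. a \<otimes> h e) = a \<otimes> (\<Sum>e\<in>F. h e)" for a :: 'a and h :: "'b \<Rightarrow> 'b" and F
    by (induction F rule: infinite_finite_induct)
      (simp_all add: tens_add_right tens_scaleC_right[of _ 0, simplified])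
  have ex: "\<exists>F. finite F \<and> (\<forall>F'. finite F' \<longrightarrow> F \<subseteq> F' \<longrightarrow> y = (\<Sum>e\<in>F'. id_tens_fun (r e) y \<otimes> e))"
    for y :: "'a \<otimes> 'b"
  proof (induction y)
    case (tens a b)
    show ?case
    proof (intro exI conjI allI impI)
      show "finite {e. r e b \<noteq> 0}" by (rule r)
      fix F' assume "finite F'" "{e. r e b \<noteq> 0} \<subseteq> F'"
      then show "a \<otimes> b = (\<Sum>e\<in>F'. id_tens_fun (r e) (a \<otimes> b) \<otimes> e)"
        using r(3)[of F' b]
        by (simp add: r(1) tens_scaleC_left tens_sum flip: tens_scaleC_right)
    qed
  next
    case (add y z)
    from add(1) obtain F where F: "finite F"
      "\<forall>F'. finite F' \<longrightarrow> F \<subseteq> F' \<longrightarrow> y = (\<Sum>e\<in>F'. id_tens_fun (r e) y \<otimes> e)" by blast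
    from add(2) obtain G where G: "finite G"
      "\<forall>F'. finite F' \<longrightarrow> G \<subseteq> F' \<longrightarrow> z = (\<Sum>e\<in>F'. id_tens_fun (r e) z \<otimes> e)" by blast
    show ?case
    proof (intro exI conjI allI impI)
      show "finite (F \<union> G)" using F G by simp
      fix F' assume "finite F'" "F \<union> G \<subseteq> F'"
      then have "y = (\<Sum>e\<in>F'. id_tens_fun (r e) y \<otimes> e)" "z = (\<Sum>e\<in>F'. id_tens_fun (r e) z \<otimes> e)"
        using F G by blast+
      then have "y + z = (\<Sum>e\<in>F'. id_tens_fun (r e) y \<otimes> e) + (\<Sum>e\<in>F'. id_tens_fun (r e) z \<otimes> e)"
        by (rule arg_cong2)
      also have "\<dots> = (\<Sum>e\<in>F'. id_tens_fun (r e) (y + z) \<otimes> e)"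
        by (simp add: r(1) tens_add_left sum.distrib)
      finally show "y + z = (\<Sum>e\<in>F'. id_tens_fun (r e) (y + z) \<otimes> e)" .
    qed
  qed
  from ex[of x] obtain F where "x = (\<Sum>e\<in>F. id_tens_fun (r e) x \<otimes> e)" by blast
  also have "\<dots> = 0"
    by (intro sum.neutral ballI) (simp add: assms r(1) tens_scaleC_left[of 0, simplified])
  finally show ?thesis .
qed

lemma clinear_fun_tens_id: "clinear f \<Longrightarrow> clinear g \<Longrightarrow> g (fun_tens_id f x) = f (id_tens_fun g x)"
  for f :: "'a::complex_vec \<Rightarrow> complex" and g :: "'b::complex_vec \<Rightarrow> complex"
  by (induction x) (simp_all, simp_all add: clinear_functional_iff)

instance tensor :: (nondegenerate_algebra, nondegenerate_algebra) nondegenerate_algebra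
proof
  fix x :: "'a \<otimes> 'b"
  show "x = 0" if x: "\<And>y. x * y = 0"
  proof (rule slices_separate, rule nondegenerate_left, rule functionals_separate)
    fix g :: "'b \<Rightarrow> complex" and c and f :: "'a \<Rightarrow> complex"
    assume g: "clinear g" and f: "clinear f"
    have fc: "clinear (\<lambda>a. f (a * c))" using f by (simp add: clinear_functional_iff distrib_right)
    have "fun_tens_id (\<lambda>a. f (a * c)) x * d = fun_tens_id f (x * (c \<otimes> d))" for d
      by (induction x) (simp_all add: f fc distrib_right)
    also have "fun_tens_id f (0 :: 'a \<otimes> 'b) = 0"
      using fun_tens_id_add[OF f, of 0 0] by simp
    then have "fun_tens_id f (x * (c \<otimes> d)) = 0" for d by (simp add: x)
    finally have "fun_tens_id (\<lambda>a. f (a * c)) x = 0" by (rule nondegenerate_left)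
    then show "f (id_tens_fun g x * c) = 0"
      using clinear_fun_tens_id[OF fc g, of x] cvec_pair.linear_0[OF g] by simp
  qed
  show "x = 0" if x: "\<And>y. y * x = 0"
  proof (rule slices_separate, rule nondegenerate_right, rule functionals_separate)
    fix g :: "'b \<Rightarrow> complex" and c and f :: "'a \<Rightarrow> complex"
    assume g: "clinear g" and f: "clinear f"
    have fc: "clinear (\<lambda>a. f (c * a))" using f by (simp add: clinear_functional_iff distrib_left)
    have "d * fun_tens_id (\<lambda>a. f (c * a)) x = fun_tens_id f ((c \<otimes> d) * x)" for d
      by (induction x) (simp_all add: f fc distrib_left)
    also have "fun_tens_id f (0 :: 'a \<otimes> 'b) = 0"
      using fun_tens_id_add[OF f, of 0 0] by simp
    then have "fun_tens_id f ((c \<otimes> d) * x) = 0" for d by (simp add: x)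
    finally have "fun_tens_id (\<lambda>a. f (c * a)) x = 0" by (rule nondegenerate_right)
    then show "f (c * id_tens_fun g x) = 0"
      using clinear_fun_tens_id[OF fc g, of x] cvec_pair.linear_0[OF g] by simp
  qed
qed


section \<open>The multiplier algebra\<close>

text \<open>A multiplier \<open>m\<close> is the pair of linear maps \<open>(b \<mapsto> m b, a \<mapsto> a m)\<close>.
  For a non-degenerate product the two module conditions follow from the last one.\<close>

definition double_centralizer ::
  "('a::complex_algebra \<Rightarrow> 'a) \<Rightarrow> ('a \<Rightarrow> 'a) \<Rightarrow> bool"
  where "double_centralizer l r \<longleftrightarrow> clinear l \<and> clinear r \<and>
    (\<forall>a b. l (a * b) = l a * b) \<and> (\<forall>a b. r (a * b) = a * r b) \<and>
    (\<forall>a b. r a * b = a * l b)"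

typedef (overloaded) 'a multiplier =
  "{(l, r). double_centralizer (l :: 'a::complex_algebra \<Rightarrow> 'a) r}"
  by (rule exI[of _ "(id, id)"]) (simp add: double_centralizer_def clinear_iff)

setup_lifting type_definition_multiplier

lift_definition mult_left :: "'a::complex_algebra multiplier \<Rightarrow> 'a \<Rightarrow> 'a" (infixr "\<rhd>" 69) is fst .

lift_definition mult_right :: "'a::complex_algebra \<Rightarrow> 'a multiplier \<Rightarrow> 'a" (infixl "\<lhd>" 69)
  is "\<lambda>a m. snd m a" .

lemma multiplier_eqI:
  "m = n" if "\<And>a. m \<rhd> a = n \<rhd> a" "\<And>a. a \<lhd> m = a \<lhd> n"
  using that by transfer (auto simp: prod_eq_iff)

lemma
  shows clinear_mult_left_mult: "clinear (\<lambda>a. m \<rhd> a)"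
    and clinear_mult_right_mult: "clinear (\<lambda>a. a \<lhd> m)"
    and mult_left_mult: "m \<rhd> (a * b) = (m \<rhd> a) * b"
    and mult_right_mult: "(a * b) \<lhd> m = a * (b \<lhd> m)"
    and mult_right_left: "(a \<lhd> m) * b = a * (m \<rhd> b)"
  by (transfer, auto simp: double_centralizer_def)+

instantiation multiplier :: (complex_algebra) "{complex_algebra, monoid_mult}"
begin
lift_definition zero_multiplier :: "'a multiplier" is "(\<lambda>_. 0, \<lambda>_. 0)"
  by (simp add: double_centralizer_def clinear_iff)
lift_definition one_multiplier :: "'a multiplier" is "(\<lambda>a. a, \<lambda>a. a)"
  by (simp add: double_centralizer_def clinear_iff)
lift_definition plus_multiplier :: "'a multiplier \<Rightarrow> 'a multiplier \<Rightarrow> 'a multiplier"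
  is "\<lambda>(l, r) (l', r'). (\<lambda>a. l a + l' a, \<lambda>a. r a + r' a)"
  by (auto simp: double_centralizer_def clinear_iff scaleC_add_right algebra_simps)
lift_definition uminus_multiplier :: "'a multiplier \<Rightarrow> 'a multiplier"
  is "\<lambda>(l, r). (\<lambda>a. - l a, \<lambda>a. - r a)"
  by (auto simp: double_centralizer_def clinear_iff)
lift_definition minus_multiplier :: "'a multiplier \<Rightarrow> 'a multiplier \<Rightarrow> 'a multiplier"
  is "\<lambda>(l, r) (l', r'). (\<lambda>a. l a - l' a, \<lambda>a. r a - r' a)"
  by (auto simp: double_centralizer_def clinear_iff cvec.scale_right_diff_distrib algebra_simps)
lift_definition scaleC_multiplier :: "complex \<Rightarrow> 'a multiplier \<Rightarrow> 'a multiplier"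
  is "\<lambda>c (l, r). (\<lambda>a. c *\<^sub>C l a, \<lambda>a. c *\<^sub>C r a)"
  by (auto simp: double_centralizer_def clinear_iff scaleC_add_right mult.commute)
lift_definition times_multiplier :: "'a multiplier \<Rightarrow> 'a multiplier \<Rightarrow> 'a multiplier"
  is "\<lambda>(l, r) (l', r'). (\<lambda>a. l (l' a), \<lambda>a. r' (r a))"
  by (auto simp: double_centralizer_def clinear_iff)
instance
  by standard (transfer; auto simp: double_centralizer_def clinear_iff scaleC_add_right
      scaleC_add_left algebra_simps)+
end

lemma mult_actions [simp]:
  "0 \<rhd> a = 0" "1 \<rhd> a = a" "(m + n) \<rhd> a = m \<rhd> a + n \<rhd> a" "(c *\<^sub>C m) \<rhd> a = c *\<^sub>C (m \<rhd> a)"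
  "(m * n) \<rhd> a = m \<rhd> n \<rhd> a"
  "a \<lhd> 0 = 0" "a \<lhd> 1 = a" "a \<lhd> (m + n) = a \<lhd> m + a \<lhd> n" "a \<lhd> (c *\<^sub>C m) = c *\<^sub>C (a \<lhd> m)"
  "a \<lhd> (m * n) = a \<lhd> m \<lhd> n"
  by (transfer; auto)+

lift_definition mult_of :: "'a::complex_algebra \<Rightarrow> 'a multiplier" is "\<lambda>a. ((*) a, \<lambda>b. b * a)"
  by (simp add: double_centralizer_def clinear_iff mult.assoc distrib_left distrib_right)

lemma mult_of_actions [simp]: "mult_of a \<rhd> b = a * b" "b \<lhd> mult_of a = b * a"
  by (transfer; simp)+

lemma inj_mult_of: "inj (mult_of :: 'a::nondegenerate_algebra \<Rightarrow> 'a multiplier)"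
proof (rule injI)
  fix a b :: 'a
  assume "mult_of a = mult_of b"
  then have "(a - b) * c = 0" for c
    using mult_of_actions(1)[of a c] by (simp add: left_diff_distrib)
  then show "a = b" using nondegenerate_left[of "a - b"] by simp
qed

lemma mult_of_mult: "mult_of (a * b) = mult_of a * mult_of b"
  and mult_of_left: "mult_of (m \<rhd> a) = m * mult_of a"
  and mult_of_right: "mult_of (a \<lhd> m) = mult_of a * m"
  by (auto intro!: multiplier_eqI simp: mult.assoc mult_left_mult mult_right_mult mult_right_left)

text \<open>The element of the algebra given by a multiplier that lies in the algebra.\<close>

definition of_mult :: "'a::nondegenerate_algebra multiplier \<Rightarrow> 'a"
  where "of_mult = inv mult_of"

lemma of_mult_of [simp]: "of_mult (mult_of a) = a"
  by (simp add: of_mult_def inv_f_f inj_mult_of)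

lift_definition mult_tens :: "'a::complex_algebra multiplier \<Rightarrow> 'b::complex_algebra multiplier
    \<Rightarrow> ('a \<otimes> 'b) multiplier" (infixr "\<otimes>\<^sub>M" 72)
  is "\<lambda>(l, r) (l', r'). (tmap l l', tmap r r')"
proof -
  fix p :: "('a \<Rightarrow> 'a) \<times> ('a \<Rightarrow> 'a)" and q :: "('b \<Rightarrow> 'b) \<times> ('b \<Rightarrow> 'b)"
  assume "p \<in> {(l, r). double_centralizer l r}" "q \<in> {(l, r). double_centralizer l r}"
  then obtain l r l' r' where p: "p = (l, r)" "double_centralizer l r"
    and q: "q = (l', r')" "double_centralizer l' r'" by auto
  have lin: "clinear l" "clinear r" "clinear l'" "clinear r'"
    using p q by (auto simp: double_centralizer_def)
  note lin' = clinear_tmap[OF lin(1,3)] clinear_tmap[OF lin(2,4)]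
  have add: "tmap l l' (x + y) = tmap l l' x + tmap l l' y"
    "tmap r r' (x + y) = tmap r r' x + tmap r r' y" for x y
    using lin' by (auto simp: clinear_iff)
  have "tmap l l' (x * y) = tmap l l' x * y" for x y
  proof (induction x)
    case (tens a b)
    then show ?case
      by (induction y) (use p q in \<open>simp_all add: lin add distrib_left double_centralizer_def\<close>)
  qed (simp_all add: add distrib_right)
  moreover have "tmap r r' (x * y) = x * tmap r r' y" for x y
  proof (induction x)
    case (tens a b)
    then show ?case
      by (induction y) (use p q in \<open>simp_all add: lin add distrib_left double_centralizer_def\<close>)
  qed (simp_all add: add distrib_right)
  moreover have "tmap r r' x * y = x * tmap l l' y" for x y
  proof (induction x)
    case (tens a b)
    then show ?case
      by (induction y) (use p q in \<open>simp_all add: lin add distrib_left double_centralizer_def\<close>)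
  qed (simp_all add: add distrib_right)
  ultimately show "(case p of (l, r) \<Rightarrow> \<lambda>(l', r'). (tmap l l', tmap r r')) q
      \<in> {(l, r). double_centralizer l r}"
    using lin' by (simp add: p q double_centralizer_def)
qed

lemma mult_tens_left: "(m \<otimes>\<^sub>M n) \<rhd> x = tmap (\<lambda>a. m \<rhd> a) (\<lambda>b. n \<rhd> b) x"
  and mult_tens_right: "x \<lhd> (m \<otimes>\<^sub>M n) = tmap (\<lambda>a. a \<lhd> m) (\<lambda>b. b \<lhd> n) x"
  by (transfer, auto)+

lemma mult_tens_actions [simp]:
  "(m \<otimes>\<^sub>M n) \<rhd> (a \<otimes> b) = (m \<rhd> a) \<otimes> (n \<rhd> b)"
  "(a \<otimes> b) \<lhd> (m \<otimes>\<^sub>M n) = (a \<lhd> m) \<otimes> (b \<lhd> n)"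
  by (simp_all add: mult_tens_left mult_tens_right clinear_mult_left_mult clinear_mult_right_mult)

lemma cbilinear_mult_tens: "cbilinear ((\<otimes>\<^sub>M) :: 'a::complex_algebra multiplier
    \<Rightarrow> 'b::complex_algebra multiplier \<Rightarrow> _)"
proof -
  have eqI: "k = k'" if "\<And>a b. k \<rhd> a \<otimes> b = k' \<rhd> a \<otimes> b" "\<And>a b. a \<otimes> b \<lhd> k = a \<otimes> b \<lhd> k'"
    for k k' :: "('a \<otimes> 'b) multiplier"
    using tensor_clinear_eqI[OF clinear_mult_left_mult[of k] clinear_mult_left_mult[of k'] that(1)]
      tensor_clinear_eqI[OF clinear_mult_right_mult[of k] clinear_mult_right_mult[of k'] that(2)]
    by (auto intro!: multiplier_eqI dest: fun_cong)
  show ?thesis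
    unfolding cbilinear_def clinear_iff
    by (intro conjI allI; rule eqI)
      (simp_all add: tens_add_left tens_add_right tens_scaleC_left tens_scaleC_right)
qed

lemma clinear_mult_of: "clinear (mult_of :: 'a::complex_algebra \<Rightarrow> _)"
  unfolding clinear_iff
  by (intro conjI allI; rule multiplier_eqI) (simp_all add: distrib_left distrib_right)

lemma cbilinear_of_mult:
  fixes F :: "'a::complex_vec \<Rightarrow> 'b::complex_vec \<Rightarrow> 'c::nondegenerate_algebra multiplier"
  assumes F: "cbilinear F" and range: "\<And>a b. F a b \<in> range mult_of"
  shows "cbilinear (\<lambda>a b. of_mult (F a b))" and "mult_of (of_mult (F a b)) = F a b"
proof -
  show eq: "mult_of (of_mult (F a b)) = F a b" for a b
    using range[of a b] by auto
  have "of_mult (mult_of x + mult_of y) = x + y" "of_mult (c *\<^sub>C mult_of x) = c *\<^sub>C x"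
    for x y :: 'c and c
    using clinear_mult_of by (metis clinear_iff of_mult_of)+
  then have add: "of_mult (F a b + F a' b') = of_mult (F a b) + of_mult (F a' b')"
    and scale: "of_mult (c *\<^sub>C F a b) = c *\<^sub>C of_mult (F a b)" for a b a' b' c
    using eq by metis+
  show "cbilinear (\<lambda>a b. of_mult (F a b))"
    using F by (auto simp: cbilinear_def clinear_iff add scale)
qed

text \<open>Transport of multipliers along an algebra isomorphism.\<close>

definition algebra_iso :: "('a::complex_algebra \<Rightarrow> 'b::complex_algebra) \<Rightarrow> bool"
  where "algebra_iso f \<longleftrightarrow> clinear f \<and> bij f \<and> (\<forall>x y. f (x * y) = f x * f y)"

definition mult_transport ::
    "('a::complex_algebra \<Rightarrow> 'b::complex_algebra) \<Rightarrow> 'a multiplier \<Rightarrow> 'b multiplier"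
  where "mult_transport f m =
    Abs_multiplier (\<lambda>y. f (m \<rhd> inv f y), \<lambda>y. f (inv f y \<lhd> m))"

lemma mult_transport_actions:
  assumes "algebra_iso f"
  shows "mult_transport f m \<rhd> f x = f (m \<rhd> x)" "f x \<lhd> mult_transport f m = f (x \<lhd> m)"
proof -
  have f: "\<And>x y. f (x + y) = f x + f y" "\<And>c x. f (c *\<^sub>C x) = c *\<^sub>C f x" "\<And>x y. f (x * y) = f x * f y"
    "bij f" using assms by (auto simp: algebra_iso_def clinear_iff)
  then have inv: "inv f (f x) = x" "f (inv f y) = y" for x y
    by (simp_all add: bij_is_inj bij_is_surj surj_f_inv_f)
  have g: "inv f (x + y) = inv f x + inv f y" "inv f (c *\<^sub>C x) = c *\<^sub>C inv f x"
    "inv f (x * y) = inv f x * inv f y" for x y c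
    by (metis f inv)+
  have "double_centralizer (\<lambda>y. f (m \<rhd> inv f y)) (\<lambda>y. f (inv f y \<lhd> m))"
    using clinear_mult_left_mult[of m] clinear_mult_right_mult[of m]
    by (auto simp: double_centralizer_def clinear_iff f g inv mult_left_mult mult_right_mult)
      (metis f(3) inv(2) mult_right_left)
  then have rep: "Rep_multiplier (mult_transport f m)
      = (\<lambda>y. f (m \<rhd> inv f y), \<lambda>y. f (inv f y \<lhd> m))"
    by (simp add: mult_transport_def Abs_multiplier_inverse)
  show "mult_transport f m \<rhd> f x = f (m \<rhd> x)" "f x \<lhd> mult_transport f m = f (x \<lhd> m)"
    by (simp_all add: mult_left.rep_eq mult_right.rep_eq rep inv)
qed

definition tassoc :: "(('a::complex_vec \<otimes> 'b::complex_vec) \<otimes> 'c::complex_vec) \<Rightarrow> ('a \<otimes> 'b \<otimes> 'c)"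
  where "tassoc = tlift (\<lambda>t c. tlift (\<lambda>a b. a \<otimes> b \<otimes> c) t)"

definition tinsert :: "(('a::complex_vec \<otimes> 'c::complex_vec) \<otimes> 'b::complex_vec) \<Rightarrow> ('a \<otimes> 'b \<otimes> 'c)"
  where "tinsert = tlift (\<lambda>t b. tlift (\<lambda>a c. a \<otimes> b \<otimes> c) t)"

lemma trilinear_tlift:
  assumes "\<And>c. cbilinear (\<lambda>a b. f a b c)" "\<And>a b. clinear (f a b)"
  shows "cbilinear (\<lambda>t c. tlift (\<lambda>a b. f a b c) t)"
proof -
  have "tlift (\<lambda>a b. f a b (c + d)) t = tlift (\<lambda>a b. f a b c) t + tlift (\<lambda>a b. f a b d) t" for t c d
  proof (induction t)
    case (tens a b)
    then show ?case using assms(2) unfolding tlift_tens[OF assms(1)] clinear_iff by blast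
  next
    case (add x y)
    then show ?case unfolding tlift_add[OF assms(1)] by simp
  qed
  moreover have "tlift (\<lambda>a b. f a b (k *\<^sub>C c)) t = k *\<^sub>C tlift (\<lambda>a b. f a b c) t" for t c k
  proof (induction t)
    case (tens a b)
    then show ?case using assms(2) unfolding tlift_tens[OF assms(1)] clinear_iff by blast
  next
    case (add x y)
    then show ?case unfolding tlift_add[OF assms(1)] by (simp add: scaleC_add_right)
  qed
  ultimately show ?thesis
    using clinear_tlift[OF assms(1)] by (simp add: cbilinear_def clinear_iff)
qed

lemma
  fixes a :: "'a::complex_vec" and b :: "'b::complex_vec" and c :: "'c::complex_vec"
  shows clinear_tassoc: "clinear (tassoc :: (('a \<otimes> 'b) \<otimes> 'c) \<Rightarrow> _)"
    and tassoc_tens [simp]: "tassoc ((a \<otimes> b) \<otimes> c) = a \<otimes> b \<otimes> c"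
    and clinear_tinsert: "clinear (tinsert :: (('a \<otimes> 'c) \<otimes> 'b) \<Rightarrow> _)"
    and tinsert_tens [simp]: "tinsert ((a \<otimes> c) \<otimes> b) = a \<otimes> b \<otimes> c"
proof -
  have 1: "cbilinear (\<lambda>(a::'a) b. a \<otimes> b \<otimes> c)" "cbilinear (\<lambda>(a::'a) c. a \<otimes> b \<otimes> c)"
    "clinear (\<lambda>b. a \<otimes> b \<otimes> c)" "clinear (\<lambda>c. a \<otimes> b \<otimes> c)"
    for a :: 'a and b :: 'b and c :: 'c
    by (simp_all add: cbilinear_def clinear_iff tens_add_left tens_add_right
        tens_scaleC_left tens_scaleC_right)
  have 2: "cbilinear (\<lambda>t (c::'c). tlift (\<lambda>(a::'a) (b::'b). a \<otimes> b \<otimes> c) t)"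
    "cbilinear (\<lambda>t (b::'b). tlift (\<lambda>(a::'a) (c::'c). a \<otimes> b \<otimes> c) t)"
    by (rule trilinear_tlift[of "\<lambda>a b c. a \<otimes> b \<otimes> c"] trilinear_tlift[of "\<lambda>a c b. a \<otimes> b \<otimes> c"];
        rule 1)+
  show "clinear (tassoc :: (('a \<otimes> 'b) \<otimes> 'c) \<Rightarrow> _)" "clinear (tinsert :: (('a \<otimes> 'c) \<otimes> 'b) \<Rightarrow> _)"
    unfolding tassoc_def tinsert_def using 2 by (auto intro: clinear_tlift)
  show "tassoc ((a \<otimes> b) \<otimes> c) = a \<otimes> b \<otimes> c" "tinsert ((a \<otimes> c) \<otimes> b) = a \<otimes> b \<otimes> c"
    unfolding tassoc_def tinsert_def
    by (simp_all only: tlift_tens[OF 2(1)] tlift_tens[OF 2(2)] tlift_tens[OF 1(1)] tlift_tens[OF 1(2)])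
qed

lemma trilinear_tlift':
  assumes "\<And>a. cbilinear (f a)" "\<And>b c. clinear (\<lambda>a. f a b c)"
  shows "cbilinear (\<lambda>a t. tlift (f a) t)"
proof -
  have "tlift (f (a + a')) t = tlift (f a) t + tlift (f a') t" for t a a'
  proof (induction t)
    case (tens a b)
    then show ?case using assms(2) unfolding tlift_tens[OF assms(1)] clinear_iff by blast
  next
    case (add x y)
    then show ?case unfolding tlift_add[OF assms(1)] by simp
  qed
  moreover have "tlift (f (k *\<^sub>C a)) t = k *\<^sub>C tlift (f a) t" for t a k
  proof (induction t)
    case (tens a b)
    then show ?case using assms(2) unfolding tlift_tens[OF assms(1)] clinear_iff by blast
  next
    case (add x y)
    then show ?case unfolding tlift_add[OF assms(1)] by (simp add: scaleC_add_right)
  qed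
  ultimately show ?thesis
    using clinear_tlift[OF assms(1)] by (simp add: cbilinear_def clinear_iff)
qed

lemma
  shows bij_tassoc: "bij (tassoc :: (('a::complex_vec \<otimes> 'b::complex_vec) \<otimes> 'c::complex_vec) \<Rightarrow> _)"
    and bij_tinsert: "bij (tinsert :: (('a \<otimes> 'c) \<otimes> 'b) \<Rightarrow> _)"
proof -
  define g where "g = tlift (\<lambda>a. tlift (\<lambda>b c. ((a :: 'a) \<otimes> (b :: 'b)) \<otimes> (c :: 'c)))"
  define h where "h = tlift (\<lambda>a. tlift (\<lambda>b c. ((a :: 'a) \<otimes> (c :: 'c)) \<otimes> (b :: 'b)))"
  have bil: "cbilinear (\<lambda>b c. ((a :: 'a) \<otimes> (b :: 'b)) \<otimes> (c :: 'c))"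
    "cbilinear (\<lambda>b c. ((a :: 'a) \<otimes> (c :: 'c)) \<otimes> (b :: 'b))" for a
    by (simp_all add: cbilinear_def clinear_iff tens_add_left tens_add_right
        tens_scaleC_left tens_scaleC_right)
  have bil': "cbilinear (\<lambda>a. tlift (\<lambda>b c. ((a :: 'a) \<otimes> (b :: 'b)) \<otimes> (c :: 'c)))"
    "cbilinear (\<lambda>a. tlift (\<lambda>b c. ((a :: 'a) \<otimes> (c :: 'c)) \<otimes> (b :: 'b)))"
    by (rule trilinear_tlift'[of "\<lambda>a b c. (a \<otimes> b) \<otimes> c"] trilinear_tlift'[of "\<lambda>a b c. (a \<otimes> c) \<otimes> b"];
        simp add: bil clinear_iff tens_add_left tens_scaleC_left)+
  have lin: "clinear g" "clinear h"
    unfolding g_def h_def by (rule clinear_tlift bil')+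
  have gh [simp]: "g (a \<otimes> b \<otimes> c) = (a \<otimes> b) \<otimes> c" "h (a \<otimes> b \<otimes> c) = (a \<otimes> c) \<otimes> b" for a b c
    unfolding g_def h_def by (simp_all add: tlift_tens bil bil')
  have add: "g (x + y) = g x + g y" "h (x + y) = h x + h y" for x y
    using lin by (simp_all add: clinear_iff)
  have add': "tassoc (x + y) = tassoc x + tassoc y" for x y :: "('a \<otimes> 'b) \<otimes> 'c"
    using clinear_tassoc[where ?'a='a and ?'b='b and ?'c='c] by (simp add: clinear_iff)
  have add'': "tinsert (x + y) = tinsert x + tinsert y" for x y :: "('a \<otimes> 'c) \<otimes> 'b"
    using clinear_tinsert[where ?'a='a and ?'b='b and ?'c='c] by (simp add: clinear_iff)
  note add = add add' add''
  have "g (tassoc x) = x" for x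
  proof (induction x)
    case (tens t c)
    show ?case by (induction t) (simp_all add: add tens_add_left)
  qed (simp add: add)
  moreover have "tassoc (g y) = y" for y
  proof (induction y)
    case (tens a t)
    show ?case by (induction t) (simp_all add: add tens_add_right)
  qed (simp add: add)
  ultimately show "bij (tassoc :: (('a \<otimes> 'b) \<otimes> 'c) \<Rightarrow> _)"
    by (intro o_bij[of g]) (simp_all add: fun_eq_iff)
  have "h (tinsert x) = x" for x
  proof (induction x)
    case (tens t c)
    show ?case by (induction t) (simp_all add: add tens_add_left)
  qed (simp add: add)
  moreover have "tinsert (h y) = y" for y
  proof (induction y)
    case (tens a t)
    show ?case by (induction t) (simp_all add: add tens_add_right)
  qed (simp add: add)
  ultimately show "bij (tinsert :: (('a \<otimes> 'c) \<otimes> 'b) \<Rightarrow> _)"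
    by (intro o_bij[of h]) (simp_all add: fun_eq_iff)
qed

lemma tensor_multiplicativeI:
  fixes f :: "(('a::complex_algebra \<otimes> 'b::complex_algebra) \<otimes> 'c::complex_algebra) \<Rightarrow> 'd::complex_algebra"
  assumes f: "clinear f"
    and mult: "\<And>a b c a' b' c'. f (((a * a') \<otimes> (b * b')) \<otimes> (c * c')) =
      f ((a \<otimes> b) \<otimes> c) * f ((a' \<otimes> b') \<otimes> c')"
  shows "f (x * y) = f x * f y"
proof (induction x)
  have add: "f (x + y) = f x + f y" for x y using f by (simp add: clinear_iff)
  {
    case (tens t c)
    show ?case
    proof (induction t)
      case (tens a b)
      show ?case
      proof (induction y)
        case (tens t' c')
        show ?case by (induction t') (simp_all add: mult add tens_add_left distrib_left)
      qed (simp add: add distrib_left)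
    qed (simp add: add tens_add_left distrib_right)
  next
    case (add x x')
    then show ?case using f by (simp add: clinear_iff distrib_right)
  }
qed

lemma algebra_iso_tassoc:
    "algebra_iso (tassoc :: (('a::complex_algebra \<otimes> 'b::complex_algebra) \<otimes> 'c::complex_algebra) \<Rightarrow> _)"
  and algebra_iso_tinsert:
    "algebra_iso (tinsert :: (('a \<otimes> 'c) \<otimes> 'b) \<Rightarrow> _)"
  by (simp_all add: algebra_iso_def clinear_tassoc clinear_tinsert bij_tassoc bij_tinsert
      tensor_multiplicativeI)

text \<open>\<open>m\<^sub>1\<^sub>3\<close>: the multiplier \<open>m\<close> acting on the first and third legs.\<close>

definition leg13 :: "('a::complex_algebra \<otimes> 'a) multiplier \<Rightarrow> ('a \<otimes> 'a \<otimes> 'a) multiplier"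
  where "leg13 m = mult_transport tinsert (m \<otimes>\<^sub>M 1)"

text \<open>\<open>m\<^sub>1\<^sub>2 = m \<otimes> 1\<close>, read in \<open>M(A \<otimes> (A \<otimes> A))\<close>; \<open>m\<^sub>2\<^sub>3\<close> is \<open>1 \<otimes>\<^sub>M m\<close>.\<close>

definition leg12 :: "('a::complex_algebra \<otimes> 'a) multiplier \<Rightarrow> ('a \<otimes> 'a \<otimes> 'a) multiplier"
  where "leg12 m = mult_transport tassoc (m \<otimes>\<^sub>M 1)"


section \<open>Weak multiplier Hopf algebras\<close>

definition T1 :: "('a::nondegenerate_algebra \<Rightarrow> ('a \<otimes> 'a) multiplier) \<Rightarrow> ('a \<otimes> 'a) \<Rightarrow> ('a \<otimes> 'a)"
  where "T1 \<Delta> = tlift (\<lambda>a b. of_mult (\<Delta> a * (1 \<otimes>\<^sub>M mult_of b)))"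

definition T2 :: "('a::nondegenerate_algebra \<Rightarrow> ('a \<otimes> 'a) multiplier) \<Rightarrow> ('a \<otimes> 'a) \<Rightarrow> ('a \<otimes> 'a)"
  where "T2 \<Delta> = tlift (\<lambda>a b. of_mult ((mult_of a \<otimes>\<^sub>M 1) * \<Delta> b))"

definition Delta_id :: "('a::nondegenerate_algebra \<Rightarrow> ('a \<otimes> 'a) multiplier)
    \<Rightarrow> ('a \<otimes> 'a) \<Rightarrow> ('a \<otimes> 'a \<otimes> 'a) multiplier"
  where "Delta_id \<Delta> = tlift (\<lambda>p q. mult_transport tassoc (\<Delta> p \<otimes>\<^sub>M mult_of q))"

definition id_Delta :: "('a::nondegenerate_algebra \<Rightarrow> ('a \<otimes> 'a) multiplier)
    \<Rightarrow> ('a \<otimes> 'a) \<Rightarrow> ('a \<otimes> 'a \<otimes> 'a) multiplier"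
  where "id_Delta \<Delta> = tlift (\<lambda>p q. mult_of p \<otimes>\<^sub>M \<Delta> q)"

locale coproduct =
  fixes \<Delta> :: "'a::nondegenerate_algebra \<Rightarrow> ('a \<otimes> 'a) multiplier"
  assumes linear: "clinear \<Delta>"
    and mult: "\<Delta> (a * b) = \<Delta> a * \<Delta> b"
    and T1_range: "\<Delta> a * (1 \<otimes>\<^sub>M mult_of b) \<in> range mult_of"
    and T2_range: "(mult_of a \<otimes>\<^sub>M 1) * \<Delta> b \<in> range mult_of"
    and coassoc: "(mult_of a \<otimes>\<^sub>M 1 \<otimes>\<^sub>M 1) * Delta_id \<Delta> (T1 \<Delta> (b \<otimes> c)) =
      id_Delta \<Delta> (T2 \<Delta> (a \<otimes> b)) * (1 \<otimes>\<^sub>M 1 \<otimes>\<^sub>M mult_of c)"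

context coproduct
begin

lemma mult_of_T1: "mult_of (T1 \<Delta> (a \<otimes> b)) = \<Delta> a * (1 \<otimes>\<^sub>M mult_of b)"
proof -
  have "cbilinear (\<lambda>a b. \<Delta> a * (1 \<otimes>\<^sub>M mult_of b))"
    using linear clinear_mult_of[where ?'a='a] cbilinear_mult_tens[where ?'a='a and ?'b='a]
    by (simp add: cbilinear_def clinear_iff distrib_left distrib_right)
  from cbilinear_of_mult[OF this T1_range] show ?thesis
    by (simp add: T1_def tlift_tens)
qed

lemma mult_of_T2: "mult_of (T2 \<Delta> (a \<otimes> b)) = (mult_of a \<otimes>\<^sub>M 1) * \<Delta> b"
proof -
  have "cbilinear (\<lambda>a b. (mult_of a \<otimes>\<^sub>M 1) * \<Delta> b)"
    using linear clinear_mult_of[where ?'a='a] cbilinear_mult_tens[where ?'a='a and ?'b='a]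
    by (simp add: cbilinear_def clinear_iff distrib_left distrib_right)
  from cbilinear_of_mult[OF this T2_range] show ?thesis
    by (simp add: T2_def tlift_tens)
qed

end

locale full_coproduct = coproduct +
  assumes full_left:
      "\<Inter> {V. cvec.subspace V \<and> (\<forall>a b. T1 \<Delta> (a \<otimes> b) \<in> cvec.span {v \<otimes> c |v c. v \<in> V})} = UNIV"
    and full_right:
      "\<Inter> {W. cvec.subspace W \<and> (\<forall>a b. T2 \<Delta> (a \<otimes> b) \<in> cvec.span {c \<otimes> w |c w. w \<in> W})} = UNIV"

definition counit ::
    "('a::nondegenerate_algebra \<Rightarrow> ('a \<otimes> 'a) multiplier) \<Rightarrow> ('a \<Rightarrow> complex) \<Rightarrow> bool"
  where "counit \<Delta> \<epsilon> \<longleftrightarrow> clinear \<epsilon> \<and>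
    (\<forall>a b. fun_tens_id \<epsilon> (T1 \<Delta> (a \<otimes> b)) = a * b) \<and>
    (\<forall>c a. id_tens_fun \<epsilon> (T2 \<Delta> (c \<otimes> a)) = c * a)"

text \<open>\<open>\<Psi>\<close> extends \<open>\<Phi> : X \<rightarrow> M(Y)\<close> to a homomorphism \<open>M(X) \<rightarrow> M(Y)\<close> with \<open>\<Psi>(1) = e\<close>.
  For \<open>\<Phi> = id \<otimes> \<Delta>\<close> the value at \<open>1\<close> is \<open>1 \<otimes> \<Delta>(1) = 1 \<otimes> E\<close>.\<close>

definition multiplier_extension ::
    "('x::complex_algebra \<Rightarrow> 'y::complex_algebra multiplier) \<Rightarrow> 'y multiplier
      \<Rightarrow> ('x multiplier \<Rightarrow> 'y multiplier) \<Rightarrow> bool"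
  where "multiplier_extension \<Phi> e \<Psi> \<longleftrightarrow> clinear \<Psi> \<and> (\<forall>m n. \<Psi> (m * n) = \<Psi> m * \<Psi> n) \<and>
    (\<forall>x. \<Psi> (mult_of x) = \<Phi> x) \<and> \<Psi> 1 = e"

definition G1_equation :: "('a::nondegenerate_algebra \<Rightarrow> ('a \<otimes> 'a) multiplier)
    \<Rightarrow> ('a \<otimes> 'a) multiplier \<Rightarrow> (('a \<otimes> 'a) \<Rightarrow> ('a \<otimes> 'a)) \<Rightarrow> bool"
  where "G1_equation \<Delta> E G1 \<longleftrightarrow> clinear G1 \<and>
    (\<forall>a b c. mult_of ((tassoc \<circ> tmap G1 id \<circ> inv tassoc)
        (of_mult (leg13 (\<Delta> a) * (1 \<otimes>\<^sub>M mult_of (b \<otimes> c))))) =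
      leg13 (\<Delta> a) * (1 \<otimes>\<^sub>M E) * (1 \<otimes>\<^sub>M mult_of (b \<otimes> c)))"

definition G2_equation :: "('a::nondegenerate_algebra \<Rightarrow> ('a \<otimes> 'a) multiplier)
    \<Rightarrow> ('a \<otimes> 'a) multiplier \<Rightarrow> (('a \<otimes> 'a) \<Rightarrow> ('a \<otimes> 'a)) \<Rightarrow> bool"
  where "G2_equation \<Delta> E G2 \<longleftrightarrow> clinear G2 \<and>
    (\<forall>a b c. mult_of (tmap id G2 (of_mult (leg12 (mult_of (a \<otimes> b)) * leg13 (\<Delta> c)))) =
      leg12 (mult_of (a \<otimes> b)) * leg12 E * leg13 (\<Delta> c))"

text \<open>\<open>\<epsilon>\<close>, \<open>E\<close>, \<open>G\<^sub>1\<close>, \<open>G\<^sub>2\<close> and (below) the antipode are determined by \<open>\<Delta>\<close>; they are parameters so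
  that no choice operator is needed.\<close>

locale weak_multiplier_hopf_algebra = full_coproduct \<Delta>
  for \<Delta> :: "'a::nondegenerate_algebra \<Rightarrow> ('a \<otimes> 'a) multiplier" +
  fixes \<epsilon> :: "'a \<Rightarrow> complex"
    and E :: "('a \<otimes> 'a) multiplier"
    and G1 G2 :: "('a \<otimes> 'a) \<Rightarrow> ('a \<otimes> 'a)"
  assumes idempotent: "idempotent_algebra TYPE('a)"
    and counit: "counit \<Delta> \<epsilon>"
    and E_idem: "E * E = E"
    and range_T1: "range (T1 \<Delta>) = range (\<lambda>x. E \<rhd> x)"
    and range_T2: "range (T2 \<Delta>) = range (\<lambda>x. x \<lhd> E)"
    and id_Delta_E: "\<exists>\<Psi>. multiplier_extension (id_Delta \<Delta>) (1 \<otimes>\<^sub>M E) \<Psi> \<and>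
      \<Psi> E = leg12 E * (1 \<otimes>\<^sub>M E) \<and> \<Psi> E = (1 \<otimes>\<^sub>M E) * leg12 E"
    and G1: "G1_equation \<Delta> E G1"
    and G2: "G2_equation \<Delta> E G2"
    and ker_T1: "{x. T1 \<Delta> x = 0} = range (\<lambda>x. x - G1 x)"
    and ker_T2: "{x. T2 \<Delta> x = 0} = range (\<lambda>x. x - G2 x)"

text \<open>The maps \<open>a \<otimes> b \<mapsto> S(a)b\<close> and \<open>a \<otimes> b \<mapsto> aS(b)\<close> into \<open>A\<close>.\<close>

definition S_mult :: "('a::complex_algebra \<Rightarrow> 'a multiplier) \<Rightarrow> ('a \<otimes> 'a) \<Rightarrow> 'a"
  where "S_mult S = tlift (\<lambda>a b. S a \<rhd> b)"

definition mult_S :: "('a::complex_algebra \<Rightarrow> 'a multiplier) \<Rightarrow> ('a \<otimes> 'a) \<Rightarrow> 'a"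
  where "mult_S S = tlift (\<lambda>a b. a \<lhd> S b)"

text \<open>The Sweedler formulas for the antipode are read by multiplying each leg that carries an
  uncovered \<open>\<Delta>\<close> with an element of \<open>A\<close>, \<open>A \<otimes> A\<close> being non-degenerate. For instance, multiplying
  \<open>\<Sum> a\<^sub>1 \<otimes> a\<^sub>2 S(a\<^sub>3) b\<close> from the left by \<open>c \<otimes> d\<close> yields \<open>\<Sum> p \<otimes> d q\<^sub>1 S(q\<^sub>2) b\<close> with
  \<open>\<Sum> p \<otimes> q = (c \<otimes> 1)\<Delta>(a) = T\<^sub>2(c \<otimes> a)\<close>, where \<open>d q\<^sub>1 \<otimes> q\<^sub>2 = T\<^sub>2(d \<otimes> q)\<close>. In the last condition, which
  is \<open>\<Sum> S(a\<^sub>1) a\<^sub>2 S(a\<^sub>3) b = S(a) b\<close>, the element \<open>\<Sum> a\<^sub>1 \<otimes> a\<^sub>2 S(a\<^sub>3) b\<close> of \<open>A \<otimes> A\<close> is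
  \<open>E(a \<otimes> b)\<close> by the first formula.\<close>

definition antipode :: "('a::nondegenerate_algebra \<Rightarrow> ('a \<otimes> 'a) multiplier)
    \<Rightarrow> ('a \<otimes> 'a) multiplier \<Rightarrow> (('a \<otimes> 'a) \<Rightarrow> ('a \<otimes> 'a)) \<Rightarrow> (('a \<otimes> 'a) \<Rightarrow> ('a \<otimes> 'a))
    \<Rightarrow> ('a \<Rightarrow> 'a multiplier) \<Rightarrow> bool"
  where "antipode \<Delta> E G1 G2 S \<longleftrightarrow>
    clinear S \<and> (\<forall>a b. S (a * b) = S b * S a) \<and>
    cvec.span {S a \<rhd> b |a b. True} = UNIV \<and> cvec.span {a \<lhd> S b |a b. True} = UNIV \<and>
    (\<forall>a b c d. (c \<otimes> d) * (E \<rhd> (a \<otimes> b)) =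
      tmap id (\<lambda>q. mult_S S (T2 \<Delta> (d \<otimes> q)) * b) (T2 \<Delta> (c \<otimes> a))) \<and>
    (\<forall>a b c d. ((a \<otimes> b) \<lhd> E) * (c \<otimes> d) =
      tmap (\<lambda>p. a * S_mult S (T1 \<Delta> (p \<otimes> c))) id (T1 \<Delta> (b \<otimes> d))) \<and>
    (\<forall>a b c. (mult_of c \<otimes>\<^sub>M 1) \<rhd> G1 (a \<otimes> b) =
      tmap id (\<lambda>q. S_mult S (T1 \<Delta> (q \<otimes> b))) (T2 \<Delta> (c \<otimes> a))) \<and>
    (\<forall>a b d. G2 (a \<otimes> b) \<lhd> (1 \<otimes>\<^sub>M mult_of d) =
      tmap (\<lambda>p. mult_S S (T2 \<Delta> (a \<otimes> p))) id (T1 \<Delta> (b \<otimes> d))) \<and>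
    (\<forall>a b. S_mult S (E \<rhd> (a \<otimes> b)) = S a \<rhd> b)"

locale regular_weak_multiplier_hopf_algebra = weak_multiplier_hopf_algebra \<Delta> \<epsilon> E G1 G2
  for \<Delta> :: "'a::nondegenerate_algebra \<Rightarrow> ('a \<otimes> 'a) multiplier"
    and \<epsilon> :: "'a \<Rightarrow> complex"
    and E :: "('a \<otimes> 'a) multiplier"
    and G1 G2 :: "('a \<otimes> 'a) \<Rightarrow> ('a \<otimes> 'a)" +
  fixes S :: "'a \<Rightarrow> 'a multiplier"
  assumes antipode: "antipode \<Delta> E G1 G2 S"
    and regular: "bij_betw S UNIV (range mult_of)"

text \<open>\<open>\<epsilon>\<^sub>t(a) = \<Sum> a\<^sub>1 S(a\<^sub>2)\<close> is the multiplier with \<open>d \<epsilon>\<^sub>t(a) = \<Sum> (d a\<^sub>1) S(a\<^sub>2)\<close> for all \<open>d\<close>;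
  it is unique because the product is non-degenerate, and exists when \<open>S\<close> is the antipode.\<close>

definition target_counit :: "('a::nondegenerate_algebra \<Rightarrow> ('a \<otimes> 'a) multiplier)
    \<Rightarrow> ('a \<Rightarrow> 'a multiplier) \<Rightarrow> 'a \<Rightarrow> 'a multiplier"
  where "target_counit \<Delta> S a = (THE m. \<forall>d. d \<lhd> m = mult_S S (T2 \<Delta> (d \<otimes> a)))"

definition left_cointegral :: "('a::nondegenerate_algebra \<Rightarrow> ('a \<otimes> 'a) multiplier)
    \<Rightarrow> ('a \<Rightarrow> 'a multiplier) \<Rightarrow> 'a multiplier \<Rightarrow> bool"
  where "left_cointegral \<Delta> S h \<longleftrightarrow>
    h \<noteq> 0 \<and> (\<forall>a. mult_of a * h = target_counit \<Delta> S a * h)"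


section \<open>Frobenius algebras\<close>

definition functional_action :: "'a::complex_algebra \<Rightarrow> ('a \<Rightarrow> complex) \<Rightarrow> 'a \<Rightarrow> complex"
  where "functional_action a \<omega> = (\<lambda>b. \<omega> (b * a))"

definition reduced_dual :: "('a::complex_algebra \<Rightarrow> complex) set"
  where "reduced_dual = {functional_action a \<omega> |a \<omega>. clinear \<omega>}"

definition frobenius_algebra :: "'a::complex_algebra itself \<Rightarrow> bool"
  where "frobenius_algebra _ \<longleftrightarrow> (\<exists>\<phi> :: 'a \<Rightarrow> 'a \<Rightarrow> complex.
    bij_betw \<phi> UNIV reduced_dual \<and> (\<forall>b. clinear (\<lambda>a. \<phi> a b)) \<and>
    (\<forall>a x. \<phi> (a * x) = functional_action a (\<phi> x)))"

end

theory Submission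
  imports Defs
begin

text \<open>
  Let \<open>\<phi>\<close> be an isomorphism of left \<open>A\<close>-modules from \<open>A\<close> onto the space of functionals \<open>\<omega>(\<cdot> a)\<close>, and let
  \<open>h\<close> be the element with \<open>\<phi>(h) = \<epsilon>\<close>. This \<open>h\<close> is the cointegral. Since \<open>A\<close> is idempotent, \<open>\<phi>\<close> is
  compatible with multipliers as well (\<open>module_map_multiplier\<close>), so both sides of
  \<open>a h = \<epsilon>\<^sub>t(a) h\<close> lie in \<open>A\<close> and are sent by \<open>\<phi>\<close> to the functionals \<open>b \<mapsto> \<epsilon>(b a)\<close> and
  \<open>b \<mapsto> \<epsilon>(b \<epsilon>\<^sub>t(a))\<close>. As \<open>\<phi>\<close> is injective, everything reduces to the identity
  \<open>\<epsilon>(b \<epsilon>\<^sub>t(a)) = \<epsilon>(b a)\<close> (\<open>counit_mult_target_counit\<close>).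

  For this identity put \<open>g(y) = \<epsilon>(b \<epsilon>\<^sub>t(y))\<close>, \<open>g'(y) = \<epsilon>(b y)\<close> and \<open>x = (id \<otimes> \<epsilon>)((a \<otimes> b)E)\<close>. Both
  functionals, applied to the middle leg of the twofold coproduct, give the same result:
  \<open>\<Sum> a c\<^sub>1 \<otimes> g(c\<^sub>2) c\<^sub>3 d = \<Sum> x c\<^sub>1 \<otimes> c\<^sub>2 d = \<Sum> a c\<^sub>1 \<otimes> g'(c\<^sub>2) c\<^sub>3 d\<close>.
  For \<open>g\<close> this is the equation that characterises \<open>G\<^sub>2\<close>, with \<open>\<epsilon>\<close> applied to its middle leg
  (\<open>G2_slice\<close>), because \<open>G\<^sub>2(b \<otimes> y) = \<Sum> b \<epsilon>\<^sub>t(y\<^sub>1) \<otimes> y\<^sub>2\<close>. For \<open>g'\<close> it follows from coassociativity and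
  \<open>\<Sum> a c\<^sub>1 \<epsilon>(b c\<^sub>2) = x c\<close> (\<open>counit_mult_slice\<close>), which holds because \<open>\<Delta>(c) = E \<Delta>(c)\<close> and
  \<open>(a \<otimes> b)E\<close> is in the range of \<open>T\<^sub>2\<close>. Fullness of \<open>\<Delta>\<close>, used on the right leg and then on the left
  leg, allows one to cancel the coproducts and leaves \<open>g = g'\<close>.

  The same fullness argument shows that the multiplier \<open>\<epsilon>\<^sub>t(a)\<close> exists
  (\<open>target_multiplier_exists\<close>).
\<close>

section \<open>Linear maps on tensor products\<close>

lemma clinear_add: "clinear f \<Longrightarrow> f (x + y) = f x + f y"
  and clinear_scale: "clinear f \<Longrightarrow> f (c *\<^sub>C x) = c *\<^sub>C f x"
  by (auto simp: clinear_iff)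

lemma clinear_zero: "clinear f \<Longrightarrow> f 0 = 0"
  using clinear_scale[of f 0 0] by simp

lemma clinear_comp: "clinear f \<Longrightarrow> clinear g \<Longrightarrow> clinear (\<lambda>x. g (f x))"
  by (simp add: clinear_iff)

lemma subspace_equalizer: "clinear f \<Longrightarrow> clinear g \<Longrightarrow> cvec.subspace {x. f x = g x}"
  by (simp add: cvec.subspace_def clinear_zero clinear_add clinear_scale)

lemma clinear_tens_left [simp]: "clinear (\<lambda>a. a \<otimes> b)"
  and clinear_tens_right [simp]: "clinear (\<lambda>b. a \<otimes> b)"
  by (simp_all add: clinear_iff tens_add_left tens_add_right tens_scaleC_left tens_scaleC_right)

lemma clinear_ident [simp]: "clinear (\<lambda>x. x)" "clinear id"
  by (simp_all add: clinear_iff)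

lemma clinear_slices [simp]:
  assumes "clinear f"
  shows "clinear (fun_tens_id f :: 'a::complex_vec \<otimes> 'b::complex_vec \<Rightarrow> _)"
    and "clinear (id_tens_fun f :: 'c::complex_vec \<otimes> 'a::complex_vec \<Rightarrow> _)"
proof -
  have "cbilinear (\<lambda>a (b::'b). f a *\<^sub>C b)" "cbilinear (\<lambda>(b::'c) a. f a *\<^sub>C b)"
    using assms unfolding clinear_functional_iff
    by (auto simp: cbilinear_def clinear_iff scaleC_add_left scaleC_add_right mult.commute)
  then show "clinear (fun_tens_id f :: 'a::complex_vec \<otimes> 'b::complex_vec \<Rightarrow> _)"
    "clinear (id_tens_fun f :: 'c::complex_vec \<otimes> 'a::complex_vec \<Rightarrow> _)"
    unfolding fun_tens_id_def id_tens_fun_def by (auto intro: clinear_tlift)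
qed

lemma fun_tens_id_zero: "fun_tens_id (\<lambda>_. 0) x = 0"
  for x :: "'a::complex_vec \<otimes> 'b::complex_vec"
proof (induction x)
  have zero: "clinear (\<lambda>_ :: 'a. 0 :: complex)" by (simp add: clinear_iff)
  {
    case (tens a b)
    show ?case by (simp only: fun_tens_id_tens[OF zero]) simp
  next
    case (add x y)
    then show ?case by (simp only: fun_tens_id_add[OF zero]) simp
  }
qed

lemma tmap_add [simp]:
  "clinear f \<Longrightarrow> clinear g \<Longrightarrow> tmap f g (x + y) = tmap f g x + tmap f g y"
  using clinear_tmap by (blast intro: clinear_add)

lemma tmap_comp:
  assumes "clinear f" "clinear g" "clinear f'" "clinear g'"
  shows "tmap f' g' (tmap f g x) = tmap (\<lambda>a. f' (f a)) (\<lambda>b. g' (g b)) x"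
  by (induction x) (simp_all add: assms clinear_comp[of f f'] clinear_comp[of g g'])

lemma fun_tens_id_tmap:
  assumes "clinear f" "clinear g" "clinear \<omega>"
  shows "fun_tens_id \<omega> (tmap f g x) = g (fun_tens_id (\<lambda>a. \<omega> (f a)) x)"
  by (induction x)
    (simp_all add: assms clinear_comp[of f \<omega>] clinear_add[of g] clinear_scale[of g])

lemma id_tens_fun_tmap:
  assumes "clinear f" "clinear g" "clinear \<omega>"
  shows "id_tens_fun \<omega> (tmap f g x) = f (id_tens_fun (\<lambda>a. \<omega> (g a)) x)"
  by (induction x)
    (simp_all add: assms clinear_comp[of g \<omega>] clinear_add[of f] clinear_scale[of f])

text \<open>Product functionals \<open>\<omega> \<otimes> \<eta>\<close> separate the points of a tensor product.\<close>

lemma double_slices_separate: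
  fixes x y :: "'a::complex_vec \<otimes> 'b::complex_vec"
  assumes "\<And>\<omega> \<eta>. clinear \<omega> \<Longrightarrow> clinear \<eta> \<Longrightarrow> \<eta> (fun_tens_id \<omega> x) = (\<eta> (fun_tens_id \<omega> y) :: complex)"
  shows "x = y"
proof -
  have "x - y = 0"
  proof (rule slices_separate, rule functionals_separate)
    fix \<eta> :: "'b \<Rightarrow> complex" and \<omega> :: "'a \<Rightarrow> complex"
    assume lin: "clinear \<eta>" "clinear \<omega>"
    have "\<omega> (id_tens_fun \<eta> (x - y)) = \<eta> (fun_tens_id \<omega> (x - y))"
      using clinear_fun_tens_id lin by metis
    also have "\<dots> = 0"
      using assms[OF lin(2,1)] lin by (simp add: cvec_pair.linear_diff)
    finally show "\<omega> (id_tens_fun \<eta> (x - y)) = 0" .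
  qed
  then show ?thesis by simp
qed

lemma linear_projection_exists:
  fixes W :: "'a::complex_vec set"
  assumes "cvec.subspace W"
  obtains p where "clinear p" "\<And>x. p x \<in> W" "\<And>x. x \<in> W \<Longrightarrow> p x = x"
proof -
  obtain B where B: "B \<subseteq> W" "cvec.independent B" "W \<subseteq> cvec.span B"
    using cvec.maximal_independent_subset by metis
  obtain p where p: "clinear p" "\<forall>x\<in>B. p x = id x" "range p = cvec.span (id ` B)"
    using cvec_pair.linear_independent_extend_subspace[OF B(2), of id] by blast
  have W: "cvec.span B = W"
    using B assms by (meson cvec.span_minimal subset_antisym)
  have "p x = x" if "x \<in> W" for x
    using cvec_pair.linear_eq_on[OF p(1) clinear_ident(2), of x B] that p(2) W by auto
  moreover have "p x \<in> W" for x
    using p(3) W by auto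
  ultimately show ?thesis using that p(1) by blast
qed

text \<open>A projection \<open>p\<close> onto \<open>W\<close> fixes all slices of \<open>t\<close>, hence \<open>id \<otimes> p\<close> fixes \<open>t\<close>, and the range of
  \<open>id \<otimes> p\<close> is the span of the tensors with second leg in \<open>W\<close>.\<close>

lemma right_leg_in_subspace:
  fixes t :: "'a::complex_vec \<otimes> 'b::complex_vec"
  assumes W: "cvec.subspace W" and slices: "\<And>\<omega>. clinear \<omega> \<Longrightarrow> fun_tens_id \<omega> t \<in> W"
  shows "t \<in> cvec.span {c \<otimes> w |c w. w \<in> W}"
proof -
  obtain p where p: "clinear p" "\<And>x. p x \<in> W" "\<And>x. x \<in> W \<Longrightarrow> p x = x"
    by (rule linear_projection_exists[OF W]) (rule that)
  have fixed: "tmap id p t = t"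
    by (rule double_slices_separate) (simp add: fun_tens_id_tmap p slices)
  have "tmap id p x \<in> cvec.span {c \<otimes> w |c w. w \<in> W}" for x :: "'a \<otimes> 'b"
  proof (induction x)
    case (tens a b)
    then show ?case using p by (auto intro: cvec.span_base)
  qed (simp add: p cvec.span_add)
  from this[of t] show ?thesis by (simp only: fixed)
qed

lemma left_leg_in_subspace:
  fixes t :: "'a::complex_vec \<otimes> 'b::complex_vec"
  assumes V: "cvec.subspace V" and slices: "\<And>\<omega>. clinear \<omega> \<Longrightarrow> id_tens_fun \<omega> t \<in> V"
  shows "t \<in> cvec.span {v \<otimes> c |v c. v \<in> V}"
proof -
  obtain p where p: "clinear p" "\<And>x. p x \<in> V" "\<And>x. x \<in> V \<Longrightarrow> p x = x"
    by (rule linear_projection_exists[OF V]) (rule that)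
  have fixed: "tmap p id t = t"
    by (rule double_slices_separate) (simp add: clinear_fun_tens_id id_tens_fun_tmap p slices)
  have "tmap p id x \<in> cvec.span {v \<otimes> c |v c. v \<in> V}" for x :: "'a \<otimes> 'b"
  proof (induction x)
    case (tens a b)
    then show ?case using p by (auto intro: cvec.span_base)
  qed (simp add: p cvec.span_add)
  from this[of t] show ?thesis by (simp only: fixed)
qed

section \<open>Multipliers of tensor products\<close>

lemma multiplier_eqI_right:
  fixes m n :: "'a::nondegenerate_algebra multiplier"
  assumes "\<And>a. a \<lhd> m = a \<lhd> n"
  shows "m = n"
proof (rule multiplier_eqI)
  fix a
  have "b * (m \<rhd> a - n \<rhd> a) = 0" for b
    using assms by (simp add: right_diff_distrib flip: mult_right_left)
  then show "m \<rhd> a = n \<rhd> a"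
    using nondegenerate_right[of "m \<rhd> a - n \<rhd> a"] by simp
qed (rule assms)

text \<open>With a non-degenerate product, the compatibility of the two actions forces their linearity and
  the module conditions: equations between elements may be tested after multiplication.\<close>

lemma multiplier_exists:
  fixes l r :: "'a::nondegenerate_algebra \<Rightarrow> 'a"
  assumes rl: "\<And>a b. r a * b = a * l b"
  obtains m where "\<And>b. m \<rhd> b = l b" "\<And>a. a \<lhd> m = r a"
proof -
  have left: "x = y" if "\<And>a. a * x = a * y" for x y :: 'a
    using nondegenerate_right[of "x - y"] that by (simp add: right_diff_distrib)
  have right: "x = y" if "\<And>b. x * b = y * b" for x y :: 'a
    using nondegenerate_left[of "x - y"] that by (simp add: left_diff_distrib)
  have "clinear l" unfolding clinear_iff
    by (intro conjI allI; rule left) (simp_all add: distrib_left flip: rl)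
  moreover have "clinear r" unfolding clinear_iff
    by (intro conjI allI; rule right) (simp_all add: rl distrib_right)
  moreover have "l (a * b) = l a * b" for a b
    by (rule left) (simp add: rl[symmetric] mult.assoc[symmetric])
  moreover have "r (a * b) = a * r b" for a b
    by (rule right) (simp add: rl mult.assoc)
  ultimately have "double_centralizer l r"
    by (simp add: double_centralizer_def rl)
  then have "Rep_multiplier (Abs_multiplier (l, r)) = (l, r)"
    by (simp add: Abs_multiplier_inverse)
  then show ?thesis
    by (intro that[of "Abs_multiplier (l, r)"]) (simp_all add: mult_left.rep_eq mult_right.rep_eq)
qed

lemma mult_action_add [simp]:
  "m \<rhd> (x + y) = m \<rhd> x + m \<rhd> y" "(x + y) \<lhd> m = x \<lhd> m + y \<lhd> m"
  by (rule clinear_add clinear_mult_left_mult clinear_mult_right_mult)+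

lemma tensor_multiplier_eqI:
  fixes m n :: "('a::nondegenerate_algebra \<otimes> 'b::nondegenerate_algebra) multiplier"
  assumes "\<And>a b. (a \<otimes> b) \<lhd> m = (a \<otimes> b) \<lhd> n"
  shows "m = n"
proof (rule multiplier_eqI_right)
  show "x \<lhd> m = x \<lhd> n" for x by (induction x) (simp_all add: assms)
qed

lemma mult_tens_mult:
  fixes m m' :: "'a::nondegenerate_algebra multiplier" and n n' :: "'b::nondegenerate_algebra multiplier"
  shows "(m \<otimes>\<^sub>M n) * (m' \<otimes>\<^sub>M n') = (m * m') \<otimes>\<^sub>M (n * n')"
  by (rule tensor_multiplier_eqI) simp

lemma mult_of_tens:
  "mult_of (a \<otimes> b) = mult_of a \<otimes>\<^sub>M mult_of (b :: 'b::nondegenerate_algebra)"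
  for a :: "'a::nondegenerate_algebra"
  by (rule tensor_multiplier_eqI) simp

lemma mult_of_add: "mult_of (a + b) = mult_of a + mult_of b"
  using clinear_mult_of by (rule clinear_add)

lemma mult_transport_eqI:
  fixes n :: "'b::nondegenerate_algebra multiplier"
  assumes f: "algebra_iso f" and n: "\<And>x. f x \<lhd> n = f (x \<lhd> m)"
  shows "mult_transport f m = n"
proof (rule multiplier_eqI_right)
  fix a
  obtain x where "a = f x"
    using f by (meson algebra_iso_def bij_pointE)
  then show "a \<lhd> mult_transport f m = a \<lhd> n"
    by (simp add: mult_transport_actions[OF f] n)
qed

lemma
  fixes f :: "'a::complex_algebra \<Rightarrow> 'b::nondegenerate_algebra"
  assumes f: "algebra_iso f"
  shows mult_transport_mult_of: "mult_transport f (mult_of x) = mult_of (f x)"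
    and mult_transport_mult: "mult_transport f m * mult_transport f n = mult_transport f (m * n)"
    and clinear_mult_transport: "clinear (mult_transport f)"
proof -
  have lin: "f (x + y) = f x + f y" "f (c *\<^sub>C x) = c *\<^sub>C f x" "f (x * y) = f x * f y" for x y c
    using f by (auto simp: algebra_iso_def clinear_iff)
  show "mult_transport f (mult_of x) = mult_of (f x)"
    by (rule mult_transport_eqI[OF f]) (simp add: lin)
  show "mult_transport f m * mult_transport f n = mult_transport f (m * n)"
    by (rule mult_transport_eqI[OF f, symmetric]) (simp add: mult_transport_actions[OF f])
  show "clinear (mult_transport f)"
    unfolding clinear_iff
    by (intro conjI allI; rule mult_transport_eqI[OF f])
      (simp_all add: mult_transport_actions[OF f] lin)
qed

lemma tensor3_induct:
  assumes "\<And>a b c. P ((a \<otimes> b) \<otimes> c)" "\<And>x y. P x \<Longrightarrow> P y \<Longrightarrow> P (x + y)"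
  shows "P (t :: ('a::complex_vec \<otimes> 'b::complex_vec) \<otimes> 'c::complex_vec)"
proof (induction t)
  case (tens s c)
  show ?case
    by (induction s) (auto simp: tens_add_left intro: assms)
qed (rule assms)

lemma tassoc_add [simp]: "tassoc (x + y) = tassoc x + tassoc y"
  and tinsert_add [simp]: "tinsert (x' + y') = tinsert x' + tinsert y'"
  by (rule clinear_add[OF clinear_tassoc] clinear_add[OF clinear_tinsert])+

text \<open>This and the next lemma turn the multipliers \<open>m\<^sub>1\<^sub>2\<close> and \<open>m\<^sub>1\<^sub>3\<close>, defined by transport, into elementary
  tensors, so that they can be multiplied leg by leg.\<close>

lemma mult_transport_tassoc:
  "mult_transport tassoc ((m \<otimes>\<^sub>M n) \<otimes>\<^sub>M k) = m \<otimes>\<^sub>M n \<otimes>\<^sub>M k"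
  for m :: "'a::nondegenerate_algebra multiplier" and n :: "'b::nondegenerate_algebra multiplier"
    and k :: "'c::nondegenerate_algebra multiplier"
proof (rule mult_transport_eqI[OF algebra_iso_tassoc])
  show "tassoc x \<lhd> m \<otimes>\<^sub>M n \<otimes>\<^sub>M k = tassoc (x \<lhd> (m \<otimes>\<^sub>M n) \<otimes>\<^sub>M k)" for x
    by (induction x rule: tensor3_induct) simp_all
qed

lemma mult_transport_tinsert:
  "mult_transport tinsert ((m \<otimes>\<^sub>M k) \<otimes>\<^sub>M n) = m \<otimes>\<^sub>M n \<otimes>\<^sub>M k"
  for m :: "'a::nondegenerate_algebra multiplier" and n :: "'b::nondegenerate_algebra multiplier"
    and k :: "'c::nondegenerate_algebra multiplier"
proof (rule mult_transport_eqI[OF algebra_iso_tinsert])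
  show "tinsert x \<lhd> m \<otimes>\<^sub>M n \<otimes>\<^sub>M k = tinsert (x \<lhd> (m \<otimes>\<^sub>M k) \<otimes>\<^sub>M n)" for x
    by (induction x rule: tensor3_induct) simp_all
qed

lemma slice_middle_tinsert:
  assumes "clinear f"
  shows "tmap id (fun_tens_id f) (tinsert (z \<otimes> q)) = f q *\<^sub>C z"
  by (induction z) (simp_all add: assms tens_scaleC_right tens_add_left scaleC_add_right)

lemma slice_middle_tassoc:
  assumes "clinear f"
  shows "tmap id (fun_tens_id f) (tassoc u) = tmap (id_tens_fun f) id u"
  by (induction u rule: tensor3_induct)
    (simp_all add: assms tens_scaleC_right tens_scaleC_left)

lemma leg12_tens: "leg12 (mult_of (a \<otimes> b)) = mult_of a \<otimes>\<^sub>M mult_of b \<otimes>\<^sub>M 1"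
  for a b :: "'a::nondegenerate_algebra"
  unfolding leg12_def mult_of_tens by (rule mult_transport_tassoc)

lemma leg12_mult: "leg12 m * leg12 n = leg12 (m * n)"
  for m n :: "('a::nondegenerate_algebra \<otimes> 'a) multiplier"
  by (simp add: leg12_def mult_transport_mult algebra_iso_tassoc mult_tens_mult)

lemma leg12_add: "leg12 (m + n) = leg12 m + leg12 n"
  for m n :: "('a::nondegenerate_algebra \<otimes> 'a) multiplier"
proof -
  have "(m + n) \<otimes>\<^sub>M 1 = m \<otimes>\<^sub>M 1 + n \<otimes>\<^sub>M (1 :: 'a multiplier)"
    using cbilinear_mult_tens[where ?'a="'a \<otimes> 'a" and ?'b='a] by (simp add: cbilinear_def clinear_iff)
  then show ?thesis
    by (simp add: leg12_def clinear_add[OF clinear_mult_transport[OF algebra_iso_tassoc]])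
qed

section \<open>The coproduct\<close>

context coproduct
begin

lemma clinear_T [simp]: "clinear (T1 \<Delta>)" "clinear (T2 \<Delta>)"
proof -
  have 1: "cbilinear (\<lambda>a b. \<Delta> a * (1 \<otimes>\<^sub>M mult_of b))" "cbilinear (\<lambda>a b. (mult_of a \<otimes>\<^sub>M 1) * \<Delta> b)"
    using linear clinear_mult_of[where ?'a='a] cbilinear_mult_tens[where ?'a='a and ?'b='a]
    by (simp_all add: cbilinear_def clinear_iff distrib_left distrib_right)
  show "clinear (T1 \<Delta>)" "clinear (T2 \<Delta>)"
    unfolding T1_def T2_def
    by (rule clinear_tlift, rule cbilinear_of_mult(1), rule 1, rule T1_range T2_range)+
qed

lemma clinear_T_slice [simp]:
  "clinear (\<lambda>p. T1 \<Delta> (p \<otimes> b))" "clinear (\<lambda>p. T2 \<Delta> (a \<otimes> p))"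
  by (simp_all add: clinear_comp[of "\<lambda>p. p \<otimes> b"] clinear_comp[of "\<lambda>p. a \<otimes> p"])

lemma T_add [simp]: "T1 \<Delta> (x + y) = T1 \<Delta> x + T1 \<Delta> y" "T2 \<Delta> (x + y) = T2 \<Delta> x + T2 \<Delta> y"
  by (simp_all add: clinear_add)

lemma T2_mult_right: "T2 \<Delta> t \<lhd> \<Delta> c = T2 \<Delta> (t \<lhd> (1 \<otimes>\<^sub>M mult_of c))"
proof (induction t)
  case (tens p q)
  have "mult_of (T2 \<Delta> (p \<otimes> q) \<lhd> \<Delta> c) = mult_of (T2 \<Delta> (p \<otimes> (q * c)))"
    by (simp add: mult_of_right mult_of_T2 mult mult.assoc)
  then show ?case
    by (simp add: inj_eq[OF inj_mult_of])
qed simp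

lemma mult_left_T2: "(a \<otimes> b) \<lhd> \<Delta> c = (1 \<otimes>\<^sub>M mult_of b) \<rhd> T2 \<Delta> (a \<otimes> c)"
proof -
  have "mult_of (a \<otimes> b) = (1 \<otimes>\<^sub>M mult_of b) * (mult_of a \<otimes>\<^sub>M 1)"
    by (simp add: mult_of_tens mult_tens_mult)
  then have "mult_of ((a \<otimes> b) \<lhd> \<Delta> c) = mult_of ((1 \<otimes>\<^sub>M mult_of b) \<rhd> T2 \<Delta> (a \<otimes> c))"
    by (simp add: mult_of_right mult_of_left mult_of_T2 mult.assoc)
  then show ?thesis
    by (simp add: inj_eq[OF inj_mult_of])
qed

text \<open>Both sides are \<open>(a \<otimes> 1)\<Delta>(b)(1 \<otimes> d)\<close>.\<close>

lemma T2_T1: "T2 \<Delta> (a \<otimes> b) \<lhd> (1 \<otimes>\<^sub>M mult_of d) = (mult_of a \<otimes>\<^sub>M 1) \<rhd> T1 \<Delta> (b \<otimes> d)"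
proof -
  have "mult_of (T2 \<Delta> (a \<otimes> b) \<lhd> (1 \<otimes>\<^sub>M mult_of d)) = mult_of ((mult_of a \<otimes>\<^sub>M 1) \<rhd> T1 \<Delta> (b \<otimes> d))"
    by (simp add: mult_of_right mult_of_left mult_of_T2 mult_of_T1 mult.assoc)
  then show ?thesis
    by (simp add: inj_eq[OF inj_mult_of])
qed

text \<open>The two sides of the coassociativity axiom are given by elements of \<open>A \<otimes> A \<otimes> A\<close>; this lemma and
  the next one name these elements, which makes coassociativity an equation between tensors.\<close>

lemma mult_of_Delta_id:
  "(mult_of a \<otimes>\<^sub>M 1 \<otimes>\<^sub>M 1) * Delta_id \<Delta> t = mult_of (tassoc (tmap (\<lambda>p. T2 \<Delta> (a \<otimes> p)) id t))"
proof (induction t)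
  have bil: "cbilinear (\<lambda>p (q :: 'a). mult_transport tassoc (\<Delta> p \<otimes>\<^sub>M mult_of q))"
    using linear clinear_mult_of[where ?'a='a] cbilinear_mult_tens[where ?'a="'a \<otimes> 'a" and ?'b='a]
      clinear_mult_transport[OF algebra_iso_tassoc[where ?'a='a and ?'b='a and ?'c='a]]
    by (simp add: cbilinear_def clinear_iff)
  {
    case (tens p q)
    have "mult_of a \<otimes>\<^sub>M 1 \<otimes>\<^sub>M 1
        = mult_transport tassoc ((mult_of a \<otimes>\<^sub>M (1 :: 'a multiplier)) \<otimes>\<^sub>M (1 :: 'a multiplier))"
      by (rule mult_transport_tassoc[symmetric])
    then show ?case
      by (simp add: Delta_id_def tlift_tens[OF bil] mult_transport_mult[OF algebra_iso_tassoc]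
          mult_tens_mult mult_transport_mult_of[OF algebra_iso_tassoc] flip: mult_of_T2 mult_of_tens)
  next
    case (add s t)
    then show ?case
      using clinear_tlift[OF bil] clinear_tassoc[where ?'a='a and ?'b='a and ?'c='a]
      by (simp add: Delta_id_def clinear_add distrib_left mult_of_add)
  }
qed

lemma mult_of_id_Delta:
  "id_Delta \<Delta> t * (1 \<otimes>\<^sub>M 1 \<otimes>\<^sub>M mult_of c) = mult_of (tmap id (\<lambda>q. T1 \<Delta> (q \<otimes> c)) t)"
proof (induction t)
  have bil: "cbilinear (\<lambda>(p :: 'a) q. mult_of p \<otimes>\<^sub>M \<Delta> q)"
    using linear clinear_mult_of[where ?'a='a] cbilinear_mult_tens[where ?'a='a and ?'b="'a \<otimes> 'a"]
    by (simp add: cbilinear_def clinear_iff)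
  {
    case (tens p q)
    show ?case
      by (simp add: id_Delta_def tlift_tens[OF bil] mult_tens_mult mult_of_T1 mult_of_tens)
  next
    case (add s t)
    then show ?case
      using clinear_tlift[OF bil]
      by (simp add: id_Delta_def clinear_add distrib_right mult_of_add)
  }
qed

lemma T2_T1_coassoc:
  "tassoc (tmap (\<lambda>p. T2 \<Delta> (a \<otimes> p)) id (T1 \<Delta> (b \<otimes> c))) = tmap id (\<lambda>q. T1 \<Delta> (q \<otimes> c)) (T2 \<Delta> (a \<otimes> b))"
  using coassoc[of a b c] by (simp add: mult_of_Delta_id mult_of_id_Delta inj_eq[OF inj_mult_of])

lemma leg12_leg13_Delta:
  "leg12 (mult_of (p \<otimes> q)) * leg13 (\<Delta> c) = mult_of (tinsert (T2 \<Delta> (p \<otimes> c) \<otimes> q))"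
proof -
  have "leg12 (mult_of (p \<otimes> q)) = mult_transport tinsert ((mult_of p \<otimes>\<^sub>M 1) \<otimes>\<^sub>M mult_of q)"
    by (simp add: leg12_tens mult_transport_tinsert)
  then show ?thesis
    by (simp add: leg13_def mult_transport_mult[OF algebra_iso_tinsert] mult_tens_mult mult_of_tens
        flip: mult_transport_mult_of[OF algebra_iso_tinsert] mult_of_T2)
qed

text \<open>The element \<open>u\<close> is \<open>w\<^sub>1\<^sub>2 \<Delta>\<^sub>1\<^sub>3(c)\<close>. A functional on the middle leg sees only the second leg of \<open>w\<close>, since
  \<open>\<Delta>\<^sub>1\<^sub>3(c)\<close> acts trivially there.\<close>

lemma slice_leg12_leg13:
  assumes f: "clinear f"
  obtains u where "leg12 (mult_of w) * leg13 (\<Delta> c) = mult_of u"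
    and "tmap id (fun_tens_id f) u = T2 \<Delta> (id_tens_fun f w \<otimes> c)"
proof -
  have "\<exists>u. leg12 (mult_of w) * leg13 (\<Delta> c) = mult_of u
    \<and> tmap id (fun_tens_id f) u = T2 \<Delta> (id_tens_fun f w \<otimes> c)"
  proof (induction w)
    case (tens p q)
    show ?case
      by (intro exI conjI, rule leg12_leg13_Delta)
        (simp only: slice_middle_tinsert[OF f] id_tens_fun_tens[OF f] tens_scaleC_left
          clinear_scale[OF clinear_T(2)])
  next
    case (add w w')
    then obtain u u' where
      "leg12 (mult_of w) * leg13 (\<Delta> c) = mult_of u"
      "tmap id (fun_tens_id f) u = T2 \<Delta> (id_tens_fun f w \<otimes> c)"
      "leg12 (mult_of w') * leg13 (\<Delta> c) = mult_of u'"
      "tmap id (fun_tens_id f) u' = T2 \<Delta> (id_tens_fun f w' \<otimes> c)"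
      by blast
    then show ?case
      by (intro exI[of _ "u + u'"]) (simp add: mult_of_add leg12_add distrib_right f tens_add_left id_def)
  qed
  with that show ?thesis by blast
qed

end

text \<open>Fullness as a proof principle: to establish a linear property of all elements of \<open>A\<close>, it suffices
  to do so for the slices of the coproduct.\<close>

lemma (in full_coproduct) right_leg_full:
  assumes W: "cvec.subspace W"
    and slices: "\<And>\<omega> a b. clinear \<omega> \<Longrightarrow> fun_tens_id \<omega> (T2 \<Delta> (a \<otimes> b)) \<in> W"
  shows "y \<in> W"
  using full_right W right_leg_in_subspace[OF W slices] by blast

lemma (in full_coproduct) left_leg_full:
  assumes V: "cvec.subspace V"
    and slices: "\<And>\<omega> a b. clinear \<omega> \<Longrightarrow> id_tens_fun \<omega> (T1 \<Delta> (a \<otimes> b)) \<in> V"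
  shows "y \<in> V"
  using full_left V left_leg_in_subspace[OF V slices] by blast

section \<open>The counit\<close>

context weak_multiplier_hopf_algebra
begin

lemma counit_linear [simp]: "clinear \<epsilon>"
  and counit_T1: "fun_tens_id \<epsilon> (T1 \<Delta> (a \<otimes> b)) = a * b"
  and counit_T2: "id_tens_fun \<epsilon> (T2 \<Delta> (a \<otimes> b)) = a * b"
  using counit by (auto simp: counit_def)

text \<open>\<open>\<Delta>(c)(1 \<otimes> q)\<close> lies in the range of the idempotent \<open>E\<close>, and the factors \<open>1 \<otimes> q\<close> separate.\<close>

lemma E_Delta: "E * \<Delta> c = \<Delta> c"
proof (rule multiplier_eqI_right)
  fix x
  have prod: "(z \<lhd> \<Delta> c) * (p \<otimes> q) = (z * T1 \<Delta> (c \<otimes> q)) \<lhd> (mult_of p \<otimes>\<^sub>M 1)" for z p q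
  proof -
    have "mult_of (p \<otimes> q) = (1 \<otimes>\<^sub>M mult_of q) * (mult_of p \<otimes>\<^sub>M 1)"
      by (simp add: mult_of_tens mult_tens_mult)
    then have "(z \<lhd> \<Delta> c) * (p \<otimes> q) = (z \<lhd> (\<Delta> c * (1 \<otimes>\<^sub>M mult_of q))) \<lhd> (mult_of p \<otimes>\<^sub>M 1)"
      by (metis mult_actions(10) mult_of_actions(2))
    then show ?thesis
      by (metis mult_of_T1 mult_of_actions(2))
  qed
  have E_T1: "E \<rhd> T1 \<Delta> t = T1 \<Delta> t" for t
  proof -
    obtain y where "T1 \<Delta> t = E \<rhd> y" using range_T1 by blast
    then show ?thesis using E_idem by (metis mult_actions(5))
  qed
  have "(x \<lhd> E \<lhd> \<Delta> c - x \<lhd> \<Delta> c) * y = 0" for y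
    by (induction y) (simp_all add: left_diff_distrib prod mult_right_left[where a=x and m=E] E_T1 distrib_left)
  then show "x \<lhd> (E * \<Delta> c) = x \<lhd> \<Delta> c"
    using nondegenerate_left[of "x \<lhd> E \<lhd> \<Delta> c - x \<lhd> \<Delta> c"] by simp
qed

text \<open>This is \<open>\<Sum> a c\<^sub>1 \<epsilon>(b c\<^sub>2) = x c\<close>. Writing \<open>(a \<otimes> b)E = \<Sum> p q\<^sub>1 \<otimes> q\<^sub>2\<close>, one has
  \<open>(a \<otimes> b)\<Delta>(c) = (a \<otimes> b)E\<Delta>(c) = \<Sum> p (q c)\<^sub>1 \<otimes> (q c)\<^sub>2\<close>, and the counit property turns the second leg into
  \<open>\<Sum> p q c\<close>, whereas \<open>x = \<Sum> p q\<close>.\<close>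

lemma counit_mult_slice:
  "id_tens_fun (\<lambda>y. \<epsilon> (b * y)) (T2 \<Delta> (a \<otimes> c)) = id_tens_fun \<epsilon> ((a \<otimes> b) \<lhd> E) * c"
proof -
  obtain t where t: "(a \<otimes> b) \<lhd> E = T2 \<Delta> t"
    using range_T2 by blast
  have "id_tens_fun (\<lambda>y. \<epsilon> (b * y)) (T2 \<Delta> (a \<otimes> c))
      = id_tens_fun \<epsilon> ((1 \<otimes>\<^sub>M mult_of b) \<rhd> T2 \<Delta> (a \<otimes> c))"
    by (simp add: mult_tens_left id_tens_fun_tmap clinear_mult_left)
  also have "\<dots> = id_tens_fun \<epsilon> ((a \<otimes> b) \<lhd> E \<lhd> \<Delta> c)"
    by (metis E_Delta mult_actions(10) mult_left_T2)
  also have "\<dots> = id_tens_fun \<epsilon> (T2 \<Delta> (t \<lhd> (1 \<otimes>\<^sub>M mult_of c)))"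
    by (simp add: t T2_mult_right)
  also have "\<dots> = id_tens_fun \<epsilon> (T2 \<Delta> t) * c"
    by (induction t) (simp_all add: counit_T2 distrib_right mult.assoc)
  finally show ?thesis by (simp add: t)
qed

lemma clinear_G2_slice: "clinear (\<lambda>y. fun_tens_id \<epsilon> (G2 (b \<otimes> y)))"
proof -
  have "clinear G2" using G2 by (simp add: G2_equation_def)
  then show ?thesis
    by (rule clinear_comp[OF clinear_comp[OF clinear_tens_right] clinear_slices(1)[OF counit_linear]])
qed

text \<open>Apply \<open>\<epsilon>\<close> to the middle leg of \<open>(id \<otimes> G\<^sub>2)((a \<otimes> b \<otimes> 1)\<Delta>\<^sub>1\<^sub>3(c)) = (a \<otimes> b \<otimes> 1)(E \<otimes> 1)\<Delta>\<^sub>1\<^sub>3(c)\<close>.\<close>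

lemma G2_slice:
  "tmap id (\<lambda>y. fun_tens_id \<epsilon> (G2 (b \<otimes> y))) (T2 \<Delta> (a \<otimes> c))
    = T2 \<Delta> (id_tens_fun \<epsilon> ((a \<otimes> b) \<lhd> E) \<otimes> c)"
proof -
  have G2_lin: "clinear G2" and G2_eq: "mult_of (tmap id G2 (of_mult (leg12 (mult_of (a \<otimes> b)) * leg13 (\<Delta> c))))
      = leg12 (mult_of (a \<otimes> b)) * leg12 E * leg13 (\<Delta> c)"
    using G2 by (auto simp: G2_equation_def)
  obtain u where u: "leg12 (mult_of ((a \<otimes> b) \<lhd> E)) * leg13 (\<Delta> c) = mult_of u"
    "tmap id (fun_tens_id \<epsilon>) u = T2 \<Delta> (id_tens_fun \<epsilon> ((a \<otimes> b) \<lhd> E) \<otimes> c)"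
    by (rule slice_leg12_leg13[OF counit_linear]) (rule that)
  have "mult_of (tmap id G2 (tinsert (T2 \<Delta> (a \<otimes> c) \<otimes> b))) = mult_of u"
    using G2_eq by (simp add: leg12_mult leg12_leg13_Delta flip: u(1) mult_of_right)
  then have "u = tmap id G2 (tinsert (T2 \<Delta> (a \<otimes> c) \<otimes> b))"
    by (simp add: inj_eq[OF inj_mult_of])
  moreover have "tmap id (fun_tens_id \<epsilon>) (tmap id G2 (tinsert (z \<otimes> b)))
      = tmap id (\<lambda>y. fun_tens_id \<epsilon> (G2 (b \<otimes> y))) z" for z :: "'a \<otimes> 'a"
    by (induction z) (simp_all add: G2_lin tens_add_left clinear_G2_slice)
  ultimately show ?thesis using u(2) by simp
qed

end

section \<open>The target counit\<close>

context regular_weak_multiplier_hopf_algebra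
begin

lemma clinear_mult_S [simp]: "clinear (mult_S S)"
proof -
  have "cbilinear (\<lambda>a b. a \<lhd> S b)"
    using antipode clinear_mult_right_mult by (auto simp: cbilinear_def clinear_iff antipode_def)
  then show ?thesis unfolding mult_S_def by (rule clinear_tlift)
qed

lemma clinear_target [simp]: "clinear (\<lambda>y. mult_S S (T2 \<Delta> (b \<otimes> y)))"
  by (simp add: clinear_comp[of "\<lambda>y. T2 \<Delta> (b \<otimes> y)"])

text \<open>In Sweedler notation this is \<open>\<Sum> \<epsilon>(b y\<^sub>1 S(y\<^sub>2)) = \<epsilon>(b y)\<close>. The functionals \<open>g\<close> and \<open>g'\<close> on the two sides
  are compared on the middle leg of \<open>\<Sum> a c\<^sub>1 \<otimes> c\<^sub>2 \<otimes> c\<^sub>3 d\<close>, where the elements \<open>a\<close> and \<open>d\<close> cover the outer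
  legs; the coproducts are then cancelled by fullness.\<close>

lemma counit_target: "\<epsilon> (mult_S S (T2 \<Delta> (b \<otimes> y))) = \<epsilon> (b * y)"
proof -
  define g where "g y = \<epsilon> (mult_S S (T2 \<Delta> (b \<otimes> y)))" for y
  define g' where "g' y = \<epsilon> (b * y)" for y
  have lin [simp]: "clinear g" "clinear g'"
    unfolding g_def g'_def
    by (simp_all add: clinear_comp[of "\<lambda>y. mult_S S (T2 \<Delta> (b \<otimes> y))"]
        clinear_comp[of "\<lambda>y. b * y"] clinear_mult_left)
  have lin_slice [simp]: "clinear (\<lambda>y. fun_tens_id f (T1 \<Delta> (y \<otimes> d)))" if "clinear f" for f d
    using that by (simp add: clinear_comp[of "\<lambda>y. T1 \<Delta> (y \<otimes> d)"])
  \<comment> \<open>The antipode formula for \<open>G\<^sub>2\<close>, with \<open>\<epsilon>\<close> applied to the first leg.\<close>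
  have slice_g: "fun_tens_id g (T1 \<Delta> (y \<otimes> d)) = fun_tens_id \<epsilon> (G2 (b \<otimes> y)) * d" for y d
  proof -
    have "G2 (b \<otimes> y) \<lhd> (1 \<otimes>\<^sub>M mult_of d)
        = tmap (\<lambda>p. mult_S S (T2 \<Delta> (b \<otimes> p))) id (T1 \<Delta> (y \<otimes> d))"
      using antipode by (simp add: antipode_def)
    then have "fun_tens_id \<epsilon> (tmap (\<lambda>p. mult_S S (T2 \<Delta> (b \<otimes> p))) id (T1 \<Delta> (y \<otimes> d)))
        = fun_tens_id \<epsilon> (G2 (b \<otimes> y) \<lhd> (1 \<otimes>\<^sub>M mult_of d))"
      by simp
    then show ?thesis
      by (simp add: fun_tens_id_tmap mult_tens_right clinear_mult_right g_def[abs_def])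
  qed
  \<comment> \<open>Both sides equal \<open>\<Sum> x c\<^sub>1 \<otimes> c\<^sub>2 d\<close> with \<open>x = (id \<otimes> \<epsilon>)((a \<otimes> b)E)\<close>.\<close>
  have slices_eq: "tmap id (\<lambda>y. fun_tens_id g (T1 \<Delta> (y \<otimes> d))) (T2 \<Delta> (a \<otimes> c))
      = tmap id (\<lambda>y. fun_tens_id g' (T1 \<Delta> (y \<otimes> d))) (T2 \<Delta> (a \<otimes> c))" for a c d
  proof -
    let ?x = "id_tens_fun \<epsilon> ((a \<otimes> b) \<lhd> E)"
    have "tmap id (\<lambda>y. fun_tens_id g (T1 \<Delta> (y \<otimes> d))) (T2 \<Delta> (a \<otimes> c))
        = tmap id (\<lambda>y. fun_tens_id \<epsilon> (G2 (b \<otimes> y))) (T2 \<Delta> (a \<otimes> c)) \<lhd> (1 \<otimes>\<^sub>M mult_of d)"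
      by (simp add: slice_g mult_tens_right tmap_comp clinear_G2_slice clinear_mult_right) (simp add: id_def)
    also have "\<dots> = (mult_of ?x \<otimes>\<^sub>M 1) \<rhd> T1 \<Delta> (c \<otimes> d)"
      by (simp add: G2_slice T2_T1)
    also have "\<dots> = tmap (\<lambda>p. id_tens_fun g' (T2 \<Delta> (a \<otimes> p))) id (T1 \<Delta> (c \<otimes> d))"
      by (simp add: g'_def[abs_def] counit_mult_slice mult_tens_left id_def)
    also have "\<dots> = tmap (id_tens_fun g') id (tmap (\<lambda>p. T2 \<Delta> (a \<otimes> p)) id (T1 \<Delta> (c \<otimes> d)))"
      by (simp add: tmap_comp) (simp add: id_def)
    also have "\<dots> = tmap id (fun_tens_id g') (tmap id (\<lambda>q. T1 \<Delta> (q \<otimes> d)) (T2 \<Delta> (a \<otimes> c)))"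
      by (simp add: slice_middle_tassoc flip: T2_T1_coassoc)
    also have "\<dots> = tmap id (\<lambda>y. fun_tens_id g' (T1 \<Delta> (y \<otimes> d))) (T2 \<Delta> (a \<otimes> c))"
      by (simp add: tmap_comp) (simp add: id_def)
    finally show ?thesis .
  qed
  \<comment> \<open>First cancellation: slices of \<open>T\<^sub>2\<close> exhaust \<open>A\<close>.\<close>
  have "y \<in> {y. fun_tens_id g (T1 \<Delta> (y \<otimes> d)) = fun_tens_id g' (T1 \<Delta> (y \<otimes> d))}" for y d
  proof (rule right_leg_full, rule subspace_equalizer)
    fix \<omega> :: "'a \<Rightarrow> complex" and a c
    assume \<omega>: "clinear \<omega>"
    from arg_cong[OF slices_eq, of "fun_tens_id \<omega>" d a c] \<omega>
    show "fun_tens_id \<omega> (T2 \<Delta> (a \<otimes> c))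
        \<in> {y. fun_tens_id g (T1 \<Delta> (y \<otimes> d)) = fun_tens_id g' (T1 \<Delta> (y \<otimes> d))}"
      by (simp add: fun_tens_id_tmap)
  qed simp_all
  then have eq: "fun_tens_id g (T1 \<Delta> (y \<otimes> d)) = fun_tens_id g' (T1 \<Delta> (y \<otimes> d))" for y d
    by blast
  \<comment> \<open>Second cancellation: so do slices of \<open>T\<^sub>1\<close>, and \<open>g\<close>, \<open>g'\<close> agree on them by the first one.\<close>
  have "y \<in> {y. g y = g' y}"
  proof (rule left_leg_full, rule subspace_equalizer)
    fix \<omega> :: "'a \<Rightarrow> complex" and a c
    assume "clinear \<omega>"
    then show "id_tens_fun \<omega> (T1 \<Delta> (a \<otimes> c)) \<in> {y. g y = g' y}"
      by (simp add: eq flip: clinear_fun_tens_id)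
  qed simp_all
  then show ?thesis by (simp add: g_def g'_def)
qed

text \<open>The antipode formula for \<open>E(a \<otimes> b)\<close> provides the left action. If \<open>q = \<Sum> \<omega>(c a\<^sub>1) a\<^sub>2\<close> is a slice of
  \<open>(c \<otimes> 1)\<Delta>(a)\<close>, then slicing \<open>(c \<otimes> d)E(a \<otimes> b) = \<Sum> c a\<^sub>1 \<otimes> d \<epsilon>\<^sub>t(a\<^sub>2) b\<close> with \<open>\<omega>\<close> gives
  \<open>(d \<epsilon>\<^sub>t(q)) b = d (\<omega>(c \<cdot>) \<otimes> id)(E(a \<otimes> b))\<close>, that is, compatible left and right actions. Such slices
  exhaust \<open>A\<close>.\<close>

lemma target_multiplier_exists: "\<exists>m. \<forall>d. d \<lhd> m = mult_S S (T2 \<Delta> (d \<otimes> a))"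
proof -
  let ?W = "{a. \<exists>m. \<forall>d. d \<lhd> m = mult_S S (T2 \<Delta> (d \<otimes> a))}"
  have "a \<in> ?W"
  proof (rule right_leg_full)
    show "cvec.subspace ?W"
      unfolding cvec.subspace_def
    proof (intro conjI ballI allI)
      show "0 \<in> ?W"
        using clinear_zero[OF clinear_target] by (auto intro: exI[of _ 0])
      show "x + y \<in> ?W" if "x \<in> ?W" "y \<in> ?W" for x y
        using that clinear_add[OF clinear_target] by clarsimp (metis mult_actions(8))
      show "k *\<^sub>C x \<in> ?W" if "x \<in> ?W" for k x
        using that clinear_scale[OF clinear_target] by clarsimp (metis mult_actions(9))
    qed
    fix \<omega> :: "'a \<Rightarrow> complex" and c a
    assume \<omega>: "clinear \<omega>"
    let ?q = "fun_tens_id \<omega> (T2 \<Delta> (c \<otimes> a))"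
    have "mult_S S (T2 \<Delta> (d \<otimes> ?q)) * b
        = d * fun_tens_id (\<lambda>x. \<omega> (c * x)) (E \<rhd> (a \<otimes> b))" for d b
    proof -
      have "(c \<otimes> d) * (E \<rhd> (a \<otimes> b))
          = tmap id (\<lambda>q. mult_S S (T2 \<Delta> (d \<otimes> q)) * b) (T2 \<Delta> (c \<otimes> a))"
        using antipode by (simp add: antipode_def)
      from arg_cong[OF this, of "fun_tens_id \<omega>"] show ?thesis
        by (simp add: times_tens_eq fun_tens_id_tmap \<omega> clinear_mult_left
            clinear_comp[OF clinear_target clinear_mult_right])
    qed
    then show "?q \<in> ?W"
      using multiplier_exists[of "\<lambda>d. mult_S S (T2 \<Delta> (d \<otimes> ?q))"
          "\<lambda>b. fun_tens_id (\<lambda>x. \<omega> (c * x)) (E \<rhd> (a \<otimes> b))"] by blast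
  qed
  then show ?thesis by simp
qed

lemma mult_target_counit: "d \<lhd> target_counit \<Delta> S a = mult_S S (T2 \<Delta> (d \<otimes> a))"
proof -
  have "\<exists>!m. \<forall>d. d \<lhd> m = mult_S S (T2 \<Delta> (d \<otimes> a))"
    using target_multiplier_exists by (metis multiplier_eqI_right)
  from theI'[OF this] show ?thesis
    by (simp add: target_counit_def)
qed

lemma counit_mult_target_counit: "\<epsilon> (b \<lhd> target_counit \<Delta> S a) = \<epsilon> (b * a)"
  by (simp add: mult_target_counit counit_target)

end

section \<open>The cointegral\<close>

text \<open>For \<open>x = c y\<close> both sides are \<open>\<phi>(y)(b m c)\<close>, and products span \<open>A\<close>.\<close>

lemma module_map_multiplier:
  fixes \<phi> :: "'a::complex_algebra \<Rightarrow> 'a \<Rightarrow> complex"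
  assumes A: "idempotent_algebra TYPE('a)"
    and lin: "\<And>b. clinear (\<lambda>a. \<phi> a b)"
    and hom: "\<And>a x. \<phi> (a * x) = functional_action a (\<phi> x)"
  shows "\<phi> (m \<rhd> x) b = \<phi> x (b \<lhd> m)"
proof -
  have "x \<in> cvec.span {a * b |a b :: 'a. True}"
    using A by (simp add: idempotent_algebra_def)
  then show ?thesis
  proof (rule cvec_pair.linear_eq_on[rotated 2])
    show "clinear (\<lambda>x. \<phi> (m \<rhd> x) b)"
      using clinear_comp[OF clinear_mult_left_mult lin] .
    show "\<phi> (m \<rhd> x) b = \<phi> x (b \<lhd> m)" if "x \<in> {a * b |a b. True}" for x
      using that by (auto simp: mult_left_mult hom functional_action_def mult_right_left)
  qed (rule lin)
qed

theorem proposition4p16: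
  fixes \<Delta> :: "'a::nondegenerate_algebra \<Rightarrow> ('a \<otimes> 'a) multiplier"
    and \<epsilon> :: "'a \<Rightarrow> complex"
    and E :: "('a \<otimes> 'a) multiplier"
    and G1 G2 :: "('a \<otimes> 'a) \<Rightarrow> ('a \<otimes> 'a)"
    and S :: "'a \<Rightarrow> 'a multiplier"
  assumes "\<exists>a :: 'a. a \<noteq> 0"
    and "regular_weak_multiplier_hopf_algebra \<Delta> \<epsilon> E G1 G2 S"
    and "frobenius_algebra TYPE('a)"
    and "\<epsilon> \<in> reduced_dual"
  shows "\<exists>h. left_cointegral \<Delta> S h"
proof -
  interpret regular_weak_multiplier_hopf_algebra \<Delta> \<epsilon> E G1 G2 S by fact
  obtain \<phi> :: "'a \<Rightarrow> 'a \<Rightarrow> complex" where bij: "bij_betw \<phi> UNIV reduced_dual"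
    and lin: "\<And>b. clinear (\<lambda>a. \<phi> a b)"
    and hom: "\<And>a x. \<phi> (a * x) = functional_action a (\<phi> x)"
    using assms(3) unfolding frobenius_algebra_def by blast
  obtain h where h: "\<phi> h = \<epsilon>"
    using bij assms(4) by (metis bij_betw_imp_surj_on imageE)
  have "h \<noteq> 0"
  proof
    assume "h = 0"
    then have "\<epsilon> = (\<lambda>_. 0)"
      using clinear_zero[OF lin] h by auto
    then have "a * b = 0" for a b :: 'a
      using counit_T1[of a b] fun_tens_id_zero[of "T1 \<Delta> (a \<otimes> b)"] by simp
    then show False
      using assms(1) nondegenerate_left by metis
  qed
  then have "mult_of h \<noteq> 0"
    by (metis clinear_mult_of clinear_zero inj_mult_of injD)
  moreover have "mult_of a * mult_of h = target_counit \<Delta> S a * mult_of h" for a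
  proof -
    have "\<phi> (a * h) = \<phi> (target_counit \<Delta> S a \<rhd> h)"
      by (rule ext) (simp add: module_map_multiplier[OF idempotent lin hom] h
          counit_mult_target_counit hom functional_action_def)
    then have "a * h = target_counit \<Delta> S a \<rhd> h"
      using bij by (simp add: bij_betw_def inj_eq)
    then show ?thesis
      by (metis mult_of_left mult_of_mult)
  qed
  ultimately show ?thesis
    unfolding left_cointegral_def by blast
qed

end
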